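(* There exist an online algorithm for learning-augmented online convex covering and an absolute constant $C>0$ such that the following holds. For every convex, monotone, differentiable $f:\mathbb{R}^n_{\ge0}\to\mathbb{R}_{\ge0}$ with $f(\mathbf 0)=0$ and monotone gradient $\nabla f$, with $p<\infty$, every online instance $A$, every advice $x'\in\mathbb{R}^n_{\ge0}$ and every $\lambda\in(0,1)$, the final solution $\bar x$ is feasible ($A\bar x\ge\mathbf 1$) and $$f(\bar x)\le \min\Big\{\tfrac{C}{1-\lambda}f(x')+\big(4p\log(1+2d^2)\big)^p\,\mathsf{OPT},\ \big(4p\log(1+\tfrac{2}{\lambda}d^2)\big)^p\,\mathsf{OPT}\Big\}.$$ Moreover, if $Ax'\ge\mathbf 1$, then $f(\bar x)\le \frac{C}{1-\lambda}f(x')$.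
   Context: Online convex covering: minimize $f(x)$ over $x\in\mathbb{R}^n_{\ge0}$ subject to $Ax\ge\mathbf 1$, where $A=(a_{ij})\in\mathbb{R}^{m\times n}_{\ge0}$. A function is monotone if $x\ge x'$ (coordinatewise) implies $f(x)\ge f(x')$; "$\nabla f$ monotone" means $x\ge x'$ implies $\nabla f(x)\ge\nabla f(x')$ coordinatewise. $p:=\sup_{x\ge\mathbf 0,\,f(x)>0}\frac{\langle x,\nabla f(x)\rangle}{f(x)}$. $d:=\max_{i\in[m]}|\{j: a_{ij}>0\}|$ is the row sparsity of $A$. Online model: $f$, $n$, the advice $x'$ and the confidence parameter $\lambda$ are given in advance; the rows $A_1,A_2,\dots$ of $A$ arrive one at a time ($m$ unknown); after row $t$ arrives the algorithm must update $x$ in a coordinatewise non-decreasing way so that $A_s x\ge 1$ for all $s\le t$, using only information revealed so far; $\bar x$ is the final vector. $\mathsf{OPT}=\min\{f(x):x\ge0, Ax\ge\mathbf 1\}$. The advice $x'$ is arbitrary (not necessarily feasible). *)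

theory Defs
  imports "HOL-Analysis.Analysis"
begin

text \<open>Vectors of R^n are represented as functions nat => real whose
coordinates with index >= n vanish; the dimension n is an explicit natural number
so that the constant C can be chosen independently of n.\<close>

type_synonym vec = "nat \<Rightarrow> real"

definition orth :: "nat \<Rightarrow> vec set" where
  "orth n = {x. \<forall>i. (i < n \<longrightarrow> 0 \<le> x i) \<and> (n \<le> i \<longrightarrow> x i = 0)}"

definition vle :: "vec \<Rightarrow> vec \<Rightarrow> bool" where
  "vle x y \<longleftrightarrow> (\<forall>i. x i \<le> y i)"

definition dotn :: "nat \<Rightarrow> vec \<Rightarrow> vec \<Rightarrow> real" where
  "dotn n a x = (\<Sum>i<n. a i * x i)"

definition normn :: "nat \<Rightarrow> vec \<Rightarrow> real" where
  "normn n h = sqrt (\<Sum>i<n. (h i)^2)"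

definition has_grad_orth :: "nat \<Rightarrow> (vec \<Rightarrow> real) \<Rightarrow> vec \<Rightarrow> vec \<Rightarrow> bool" where
  "has_grad_orth n f g x \<longleftrightarrow>
     (\<forall>e>0. \<exists>\<delta>>0. \<forall>y\<in>orth n. normn n (\<lambda>i. y i - x i) < \<delta> \<longrightarrow>
        \<bar>f y - f x - dotn n g (\<lambda>i. y i - x i)\<bar> \<le> e * normn n (\<lambda>i. y i - x i))"

definition convex_orth :: "nat \<Rightarrow> (vec \<Rightarrow> real) \<Rightarrow> bool" where
  "convex_orth n f \<longleftrightarrow> (\<forall>x\<in>orth n. \<forall>y\<in>orth n. \<forall>t::real. 0 \<le> t \<and> t \<le> 1 \<longrightarrow>
      f (\<lambda>i. (1 - t) * x i + t * y i) \<le> (1 - t) * f x + t * f y)"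

definition mono_orth :: "nat \<Rightarrow> (vec \<Rightarrow> real) \<Rightarrow> bool" where
  "mono_orth n f \<longleftrightarrow> (\<forall>x\<in>orth n. \<forall>y\<in>orth n. vle x y \<longrightarrow> f x \<le> f y)"

definition grad_mono_orth :: "nat \<Rightarrow> (vec \<Rightarrow> vec) \<Rightarrow> bool" where
  "grad_mono_orth n g \<longleftrightarrow> (\<forall>x\<in>orth n. \<forall>y\<in>orth n. vle x y \<longrightarrow> (\<forall>i<n. g x i \<le> g y i))"

definition pset :: "nat \<Rightarrow> (vec \<Rightarrow> real) \<Rightarrow> (vec \<Rightarrow> vec) \<Rightarrow> real set" where
  "pset n f g = {dotn n x (g x) / f x | x. x \<in> orth n \<and> f x > 0}"

text \<open>p := sup of pset (convention: 0 if the set is empty, i.e. f vanishes identically).\<close>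
definition pval :: "nat \<Rightarrow> (vec \<Rightarrow> real) \<Rightarrow> (vec \<Rightarrow> vec) \<Rightarrow> real" where
  "pval n f g = (if pset n f g = {} then 0 else Sup (pset n f g))"

definition admissible_cost :: "nat \<Rightarrow> (vec \<Rightarrow> real) \<Rightarrow> (vec \<Rightarrow> vec) \<Rightarrow> bool" where
  "admissible_cost n f g \<longleftrightarrow>
     convex_orth n f \<and> mono_orth n f \<and> (\<forall>x\<in>orth n. 0 \<le> f x) \<and> f (\<lambda>_. 0) = 0 \<and>
     (\<forall>x\<in>orth n. g x \<in> orth n \<and> has_grad_orth n f (g x) x) \<and>
     grad_mono_orth n g \<and> bdd_above (pset n f g)"

definition valid_row :: "nat \<Rightarrow> vec \<Rightarrow> bool" where
  "valid_row n a \<longleftrightarrow> a \<in> orth n \<and> (\<exists>j<n. 0 < a j)"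

definition feasible :: "nat \<Rightarrow> vec list \<Rightarrow> vec \<Rightarrow> bool" where
  "feasible n rs x \<longleftrightarrow> x \<in> orth n \<and> (\<forall>a\<in>set rs. 1 \<le> dotn n a x)"

definition OPT :: "nat \<Rightarrow> (vec \<Rightarrow> real) \<Rightarrow> vec list \<Rightarrow> real" where
  "OPT n f rs = Inf (f ` {x. feasible n rs x})"

definition row_sparsity :: "nat \<Rightarrow> vec list \<Rightarrow> nat" where
  "row_sparsity n rs = Max ((\<lambda>a. card {j. j < n \<and> 0 < a j}) ` set rs)"

end

(* For a comparison solution xi and a row a with a xi >= 1, let every coordinate x_j grow at rate
   (a_j x_j + 1/(2k)) / (grad_j f)(x), where k is the sparsity of the row. The cost of such a move is
   bounded by 3/2 of its duration (8/5 after discretisation), while the potential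
   sum_j xi_j (grad_j f)(x) ln (1 + 2 d min (x_j / xi_j, 5 d)) pays for the duration. As gradients
   only increase, the final cost is at most R <xi, grad f x> with R = (7/2) ln (1 + 2 d^2), and
   convexity together with <x, grad f x> <= p f x turns this into f x <= (R p)^p f xi, with some room left
   below (4 p ln (1 + 2 d^2))^p.

   This room makes it possible to buy the advice x' at a moment when the robust budget already exceeds a
   multiple of f x', provided that f (x' + x) is still O(f x') at this moment. For bounded p it is so if
   one waits long enough. For large p the moves before the purchase follow the gradient of
   f x + theta f (x' + x), with weights theta that are piecewise constant in the budget. After the
   purchase, nothing more is spent as long as x' is feasible. *)

theory Submission
  imports Defs
begin

section \<open>One row against a cost with monotone gradient\<close>

text \<open>Neither the final d nor the comparison solution is known online. So a move uses only its
  own row's sparsity k, and its guarantee is proved for all xi and all D >= k at once; both are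
  fixed only in the analysis. The gradient is only assumed monotone and may vanish, so no
  differential equation is solved: coordinates are raised in quanta of cost, and a direction of
  constant cost is taken for free.

  The room below 4 is used as 4 > (26/25)^2 * (91/25) with 91/25 = (26/25) * (7/2). The factor
  inside 91/25 leaves at least 1/26 of f x after its own gradient term is moved to the left; with
  7/2 alone only f x / p would be left. Of the other two, raised to the power p, one is the
  overshoot of a phase's scale over the budget at which the phase begins, which makes the scales
  geometric, and the other absorbs the constant 26 (exp 728 + 3). The latter needs p above an
  absolute threshold P; below P, C may depend on P, and waiting for a large multiple of f x'
  replaces the phases.\<close>

lemma orth_nonneg: "x \<in> orth n \<Longrightarrow> 0 \<le> x i"
  unfolding orth_def by (cases "i < n") auto

lemma orth_add: "x \<in> orth n \<Longrightarrow> y \<in> orth n \<Longrightarrow> (\<lambda>i. x i + y i) \<in> orth n"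
  unfolding orth_def by auto

lemma orth_scale: "x \<in> orth n \<Longrightarrow> 0 \<le> s \<Longrightarrow> (\<lambda>i. s * x i) \<in> orth n"
  unfolding orth_def by auto

lemma orth_max: "x \<in> orth n \<Longrightarrow> y \<in> orth n \<Longrightarrow> (\<lambda>i. max (x i) (y i)) \<in> orth n"
  unfolding orth_def by (auto simp: le_max_iff_disj)

lemma orth_upd: "x \<in> orth n \<Longrightarrow> j < n \<Longrightarrow> 0 \<le> v \<Longrightarrow> x(j := v) \<in> orth n"
  unfolding orth_def by auto

lemma vle_refl: "vle x x"
  unfolding vle_def by simp

lemma vle_trans: "vle x y \<Longrightarrow> vle y z \<Longrightarrow> vle x z"
  unfolding vle_def using order_trans by blast

lemma dotn_mono: "a \<in> orth n \<Longrightarrow> vle x y \<Longrightarrow> dotn n a x \<le> dotn n a y"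
  unfolding dotn_def vle_def by (intro sum_mono mult_left_mono) (auto simp: orth_nonneg)

lemma dotn_upd: "j < n \<Longrightarrow> dotn n a (x(j := x j + h)) = dotn n a x + a j * h"
proof -
  assume j: "j < n"
  have "dotn n a (x(j := x j + h)) = (\<Sum>i<n. a i * x i + (if i = j then a j * h else 0))"
    unfolding dotn_def by (intro sum.cong) (auto simp: algebra_simps)
  also have "\<dots> = dotn n a x + a j * h"
    using j by (simp add: sum.distrib dotn_def)
  finally show ?thesis .
qed

text \<open>These properties pass from f to f x + theta f (y + x), so one construction serves the
  plain cost and the costs of all phases. A raise is measured by the gradient at its end.
  \<open>free_or_strict\<close> decides for each coordinate, uniformly in the position, whether
  raising it costs anything.\<close>

locale monotone_cost =
  fixes n :: nat and F :: "vec \<Rightarrow> real" and G :: "vec \<Rightarrow> vec"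
  assumes F_mono: "x \<in> orth n \<Longrightarrow> y \<in> orth n \<Longrightarrow> vle x y \<Longrightarrow> F x \<le> F y"
    and G_nonneg: "x \<in> orth n \<Longrightarrow> 0 \<le> G x i"
    and G_mono: "x \<in> orth n \<Longrightarrow> y \<in> orth n \<Longrightarrow> vle x y \<Longrightarrow> i < n \<Longrightarrow> G x i \<le> G y i"
    and F_grad: "x \<in> orth n \<Longrightarrow> j < n \<Longrightarrow> 0 \<le> h \<Longrightarrow>
       F (x(j := x j + h)) - F x \<le> G (x(j := x j + h)) j * h"
    and F_cont: "x \<in> orth n \<Longrightarrow> j < n \<Longrightarrow> continuous_on {0..} (\<lambda>h. F (x(j := x j + h)))"
    and free_or_strict: "j < n \<Longrightarrow>
       (\<forall>x\<in>orth n. \<forall>h\<ge>0. F (x(j := x j + h)) = F x) \<or>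
       (\<forall>x\<in>orth n. \<forall>h>0. F x < F (x(j := x j + h)))"

definition supp :: "nat \<Rightarrow> vec \<Rightarrow> nat set" where
  "supp n a = {j. j < n \<and> 0 < a j}"

lemma finite_supp [simp]: "finite (supp n a)"
  unfolding supp_def by simp

lemma dotn_supp: "a \<in> orth n \<Longrightarrow> dotn n a x = (\<Sum>j\<in>supp n a. a j * x j)"
  unfolding dotn_def supp_def
  by (rule sum.mono_neutral_right) (auto simp: orth_def order.antisym not_less)

lemma card_supp_pos: "valid_row n a \<Longrightarrow> 0 < card (supp n a)"
  unfolding valid_row_def supp_def by (auto simp: card_gt_0_iff)

text \<open>The functions through which a move of one coordinate is measured: their derivative
  dominates \<open>1 / (c y + s)\<close>, stated as a difference inequality.\<close>

definition clock_fun :: "real \<Rightarrow> real \<Rightarrow> (real \<Rightarrow> real) \<Rightarrow> bool" where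
  "clock_fun c s \<Psi> \<longleftrightarrow> (\<forall>y z. 0 \<le> y \<and> y \<le> z \<and> c * z \<le> 1 \<longrightarrow> (z - y) / (c * z + s) \<le> \<Psi> z - \<Psi> y)"

lemma clock_fun_mono:
  assumes "clock_fun c s \<Psi>" "0 \<le> c" "0 < s" "0 \<le> y" "y \<le> z" "c * z \<le> 1"
  shows "\<Psi> y \<le> \<Psi> z"
proof -
  have "0 \<le> (z - y) / (c * z + s)" using assms by simp
  also have "\<dots> \<le> \<Psi> z - \<Psi> y" using assms unfolding clock_fun_def by blast
  finally show ?thesis by simp
qed

section \<open>Discretised motion for one row\<close>

locale row_step = monotone_cost +
  fixes a x :: vec and s \<epsilon> :: real
  assumes a: "a \<in> orth n" and x: "x \<in> orth n" and s_pos: "0 < s" and eps_pos: "0 < \<epsilon>"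
    and strict: "j \<in> supp n a \<Longrightarrow> y \<in> orth n \<Longrightarrow> 0 < h \<Longrightarrow> F y < F (y(j := y j + h))"
begin

abbreviation "S \<equiv> supp n a"

text \<open>Integrated form of y_j' = (a_j y_j + s) / G_j after c_j quanta, with the gradient at the
  latest point, where it is largest. Admitting every clock function keeps the move independent of
  any comparison solution.\<close>

definition clocked :: "vec \<Rightarrow> (nat \<Rightarrow> nat) \<Rightarrow> bool" where
  "clocked y c \<longleftrightarrow> (\<forall>j\<in>S. \<forall>\<Psi>. clock_fun (a j) s \<Psi> \<longrightarrow> c j * \<epsilon> \<le> G y j * (\<Psi> (y j) - \<Psi> (x j)))"

definition above :: "vec \<Rightarrow> (nat \<Rightarrow> nat) \<Rightarrow> bool" where
  "above y c \<longleftrightarrow> y \<in> orth n \<and> vle x y \<and> (\<forall>i. i \<notin> S \<longrightarrow> y i = x i) \<and>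
     F y - F x \<le> \<epsilon> * (\<Sum>j\<in>S. c j * (a j * y j + s))"

definition running :: "vec \<Rightarrow> (nat \<Rightarrow> nat) \<Rightarrow> bool" where
  "running y c \<longleftrightarrow> above y c \<and> clocked y c \<and> dotn n a y < 1 \<and>
     \<epsilon> * s * (\<Sum>j\<in>S. real (c j)) \<le> F y - F x"

text \<open>The row may become covered in the middle of a round, when some counters are N + 1 and
  others N. The cost is then bounded with N + 1 and the clocks with N.\<close>

definition finished :: "vec \<Rightarrow> nat \<Rightarrow> bool" where
  "finished y N \<longleftrightarrow> above y (\<lambda>_. Suc N) \<and> clocked y (\<lambda>_. N) \<and> dotn n a y = 1"

lemma coord_le_one:
  assumes "y \<in> orth n" "dotn n a y \<le> 1" "j \<in> S"
  shows "a j * y j \<le> 1"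
proof -
  have "a j * y j \<le> (\<Sum>i\<in>S. a i * y i)"
    using assms a by (intro member_le_sum) (auto simp: orth_nonneg)
  then show ?thesis using assms(2) dotn_supp[OF a, of y] by simp
qed

lemma clocked_move:
  assumes c: "clocked y c" and y: "y \<in> orth n" "vle x y" and z: "z \<in> orth n" "vle y z"
    and az: "dotn n a z \<le> 1"
  shows "clocked z c"
  unfolding clocked_def
proof (intro ballI allI impI)
  fix j \<Psi> assume j: "j \<in> S" and \<Psi>: "clock_fun (a j) s \<Psi>"
  have jn: "j < n" and aj: "0 < a j" using j by (auto simp: supp_def)
  have xy: "0 \<le> x j" "x j \<le> y j" "y j \<le> z j" using x y z by (auto simp: vle_def orth_nonneg)
  have az1: "a j * z j \<le> 1" using coord_le_one[OF z(1) az j] .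
  have ay1: "a j * y j \<le> 1"
    using az1 xy(3) aj by (meson less_eq_real_def mult_left_mono order_trans)
  have "c j * \<epsilon> \<le> G y j * (\<Psi> (y j) - \<Psi> (x j))" using c j \<Psi> unfolding clocked_def by blast
  also have "\<dots> \<le> G z j * (\<Psi> (z j) - \<Psi> (x j))"
    using clock_fun_mono[OF \<Psi>, of "x j" "y j"] clock_fun_mono[OF \<Psi>, of "y j" "z j"] aj s_pos xy ay1 az1 G_mono[OF y(1) z jn] G_nonneg[OF y(1)] G_nonneg[OF z(1)]
    by (intro mult_mono) auto
  finally show "c j * \<epsilon> \<le> G z j * (\<Psi> (z j) - \<Psi> (x j))" .
qed

lemma above_move:
  assumes "running y c" and j: "j \<in> S" and h: "0 \<le> h"
    and z: "z = y(j := y j + h)" and F: "F z - F y \<le> \<epsilon> * (a j * z j + s)"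
  shows "above z (c(j := Suc (c j)))" "vle y z"
proof -
  have y: "y \<in> orth n" "vle x y" "\<forall>i. i \<notin> S \<longrightarrow> y i = x i"
    and Fy: "F y - F x \<le> \<epsilon> * (\<Sum>j\<in>S. c j * (a j * y j + s))"
    using assms(1) unfolding running_def above_def by auto
  have jn: "j < n" using j by (simp add: supp_def)
  show yz: "vle y z" using h by (simp add: z vle_def)
  have zo: "z \<in> orth n" using orth_upd[OF y(1) jn] orth_nonneg[OF y(1), of j] h by (simp add: z)
  have "(\<Sum>i\<in>S. c i * (a i * y i + s)) + (a j * z j + s)
      \<le> (\<Sum>i\<in>S. c i * (a i * z i + s)) + (a j * z j + s)"
    using yz a by (intro add_right_mono sum_mono mult_left_mono) (auto simp: vle_def orth_nonneg)
  also have "\<dots> = (\<Sum>i\<in>S. c i * (a i * z i + s) + (if i = j then a j * z j + s else 0))"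
    using j by (simp add: sum.distrib)
  also have "\<dots> = (\<Sum>i\<in>S. (c(j := Suc (c j))) i * (a i * z i + s))"
    by (intro sum.cong) (auto simp: algebra_simps)
  finally have "\<epsilon> * ((\<Sum>i\<in>S. c i * (a i * y i + s)) + (a j * z j + s))
      \<le> \<epsilon> * (\<Sum>i\<in>S. (c(j := Suc (c j))) i * (a i * z i + s))"
    using eps_pos by simp
  then show "above z (c(j := Suc (c j)))"
    unfolding above_def using zo vle_trans[OF y(2) yz] y(3) j Fy F z by (auto simp: distrib_left)
qed

text \<open>Coordinate j is raised until the raise has cost exactly one quantum eps (a_j z_j + s),
  where z is the new point, or until the row is tight (at height H). The excess q over the quantum
  is negative at 0, so if it is positive at H, the intermediate value theorem gives a raise of
  exactly one quantum.\<close>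

lemma micro_step:
  assumes run: "running y c" and j: "j \<in> S"
  shows "(\<exists>z. running z (c(j := Suc (c j)))) \<or>
    (\<exists>z. above z (c(j := Suc (c j))) \<and> clocked z c \<and> dotn n a z = 1)"
proof -
  have y: "y \<in> orth n" "vle x y" and cl: "clocked y c" and ay: "dotn n a y < 1"
    and low: "\<epsilon> * s * (\<Sum>j\<in>S. real (c j)) \<le> F y - F x"
    using run unfolding running_def above_def by auto
  have jn: "j < n" and aj: "0 < a j" using j by (auto simp: supp_def)
  define q where "q h = F (y(j := y j + h)) - F y - \<epsilon> * (a j * (y j + h) + s)" for h
  define H where "H = (1 - dotn n a y) / a j"
  have H: "0 < H" "a j * H = 1 - dotn n a y" using ay aj by (auto simp: H_def)
  have q0: "q 0 < 0"
    using s_pos eps_pos aj orth_nonneg[OF y(1), of j] by (simp add: q_def add_nonneg_pos)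
  have dz: "dotn n a (y(j := y j + h)) = dotn n a y + a j * h" for h using dotn_upd[OF jn] .
  have zo: "y(j := y j + h) \<in> orth n" if "0 \<le> h" for h
    using orth_upd[OF y(1) jn] orth_nonneg[OF y(1), of j] that by simp
  show ?thesis
  proof (cases "q H \<le> 0")
    case True
    define z where "z = y(j := y j + H)"
    have "F z - F y \<le> \<epsilon> * (a j * z j + s)" using True by (simp add: q_def z_def)
    then have ab: "above z (c(j := Suc (c j)))" "vle y z"
      using above_move[OF run j _ z_def] H by auto
    have az: "dotn n a z = 1" using dz[of H] H by (simp add: z_def)
    show ?thesis using ab az clocked_move[OF cl y _ ab(2)] by (auto simp: above_def)
  next
    case False
    have "continuous_on {0..H} q"
      unfolding q_def
      by (intro continuous_intros continuous_on_subset[OF F_cont[OF y(1) jn]]) auto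
    then obtain h where h: "0 \<le> h" "h \<le> H" "q h = 0"
      using IVT'[of q 0 0 H] q0 False H by force
    have hH: "h < H" using h False by (cases "h = H") auto
    define z where "z = y(j := y j + h)"
    have Fz: "F z - F y = \<epsilon> * (a j * z j + s)" using h by (simp add: q_def z_def)
    then have ab: "above z (c(j := Suc (c j)))" "vle y z"
      using above_move[OF run j _ z_def] h by auto
    have z: "z \<in> orth n" using ab by (simp add: above_def)
    have "a j * h < a j * H" using hH aj by simp
    then have az: "dotn n a z < 1" using dz[of h] H by (simp add: z_def)
    have cz: "clocked z c" using clocked_move[OF cl y z ab(2)] az by simp
    have "clocked z (c(j := Suc (c j)))"
      unfolding clocked_def
    proof (intro ballI allI impI)
      fix i \<Psi> assume i: "i \<in> S" and \<Psi>: "clock_fun (a i) s \<Psi>"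
      show "(c(j := Suc (c j))) i * \<epsilon> \<le> G z i * (\<Psi> (z i) - \<Psi> (x i))"
      proof (cases "i = j")
        case False
        then show ?thesis using cz i \<Psi> by (auto simp: clocked_def)
      next
        case True
        have pos: "0 < a j * z j + s"
          using aj s_pos orth_nonneg[OF z, of j] by (simp add: add_nonneg_pos)
        have zj: "z j - y j = h" by (simp add: z_def)
        \<comment> \<open>The raise costs at most h times the gradient at its end, and a clock
          function gains at least h / (a_j z_j + s) on it: one quantum of cost buys at least eps of
          clock.\<close>
        have "\<epsilon> * (a j * z j + s) \<le> G z j * h"
          using F_grad[OF y(1) jn h(1)] Fz by (simp add: z_def)
        then have "\<epsilon> \<le> G z j * (h / (a j * z j + s))" using pos by (simp add: field_simps)
        also have "\<dots> \<le> G z j * (\<Psi> (z j) - \<Psi> (y j))"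
        proof (intro mult_left_mono)
          show "h / (a j * z j + s) \<le> \<Psi> (z j) - \<Psi> (y j)"
            using \<Psi> zj h(1) coord_le_one[OF z _ j] az orth_nonneg[OF y(1), of j] True
            unfolding clock_fun_def by (metis diff_ge_0_iff_ge less_eq_real_def)
        qed (rule G_nonneg[OF z])
        finally have 1: "\<epsilon> \<le> G z j * (\<Psi> (z j) - \<Psi> (y j))" .
        have xy: "x j \<le> y j" "0 \<le> x j" using y x by (auto simp: vle_def orth_nonneg)
        have "a j * y j \<le> 1" using coord_le_one[OF y(1) _ j] ay by simp
        then have "0 \<le> \<Psi> (y j) - \<Psi> (x j)"
          using clock_fun_mono[OF \<Psi>, of "x j" "y j"] xy True s_pos aj by simp
        then have "c j * \<epsilon> \<le> G z j * (\<Psi> (y j) - \<Psi> (x j))"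
          using cl j \<Psi> True G_mono[OF y(1) z ab(2) jn] unfolding clocked_def
          by (meson mult_right_mono order_trans)
        then show ?thesis using 1 True by (simp add: algebra_simps)
      qed
    qed
    moreover have "(\<Sum>i\<in>S. real ((c(j := Suc (c j))) i)) = (\<Sum>i\<in>S. real (c i)) + 1"
    proof -
      have "(\<Sum>i\<in>S. real ((c(j := Suc (c j))) i)) = (\<Sum>i\<in>S. real (c i) + (if i = j then 1 else 0))"
        by (intro sum.cong) auto
      then show ?thesis using j by (simp add: sum.distrib)
    qed
    moreover have "\<epsilon> * s \<le> F z - F y"
      using Fz eps_pos aj orth_nonneg[OF z, of j] by simp
    ultimately have "running z (c(j := Suc (c j)))"
      unfolding running_def using ab az low by (simp add: distrib_left)
    then show ?thesis by blast
  qed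
qed

lemma above_mono: "above y c \<Longrightarrow> (\<And>j. j \<in> S \<Longrightarrow> c j \<le> c' j) \<Longrightarrow> above y c'"
proof -
  assume ab: "above y c" and le: "\<And>j. j \<in> S \<Longrightarrow> c j \<le> c' j"
  have y: "y \<in> orth n" using ab by (simp add: above_def)
  have "\<epsilon> * (\<Sum>j\<in>S. c j * (a j * y j + s)) \<le> \<epsilon> * (\<Sum>j\<in>S. c' j * (a j * y j + s))"
    using le eps_pos s_pos a orth_nonneg[OF y]
    by (intro mult_left_mono sum_mono mult_right_mono) (auto simp: orth_nonneg intro: add_nonneg_nonneg)
  then show ?thesis using ab unfolding above_def by force
qed

lemma clocked_mono: "clocked y c \<Longrightarrow> (\<And>j. j \<in> S \<Longrightarrow> c' j \<le> c j) \<Longrightarrow> clocked y c'"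
  unfolding clocked_def
proof (intro ballI allI impI)
  fix j \<Psi>
  assume "\<forall>j\<in>S. \<forall>\<Psi>. clock_fun (a j) s \<Psi> \<longrightarrow> c j * \<epsilon> \<le> G y j * (\<Psi> (y j) - \<Psi> (x j))"
    and "\<And>j. j \<in> S \<Longrightarrow> c' j \<le> c j" "j \<in> S" "clock_fun (a j) s \<Psi>"
  moreover from this(2,3) have "c' j * \<epsilon> \<le> c j * \<epsilon>" using eps_pos by simp
  ultimately show "c' j * \<epsilon> \<le> G y j * (\<Psi> (y j) - \<Psi> (x j))" by force
qed

lemma round_step:
  assumes run: "running y (\<lambda>_. N)" and "J \<subseteq> S"
  shows "(\<exists>z. running z (\<lambda>i. if i \<in> J then Suc N else N)) \<or> (\<exists>z. finished z N)"
proof -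
  have "finite J" by (rule finite_subset[OF assms(2)]) simp
  then show ?thesis using assms(2)
  proof (induction J)
    case empty
    then show ?case using run by auto
  next
    case (insert j J)
    then consider (r) z where "running z (\<lambda>i. if i \<in> J then Suc N else N)" | (f) z where "finished z N"
      by auto
    then show ?case
    proof cases
      case r
      let ?c = "\<lambda>i. if i \<in> J then Suc N else N"
      have eq: "?c(j := Suc (?c j)) = (\<lambda>i. if i \<in> insert j J then Suc N else N)"
        using insert.hyps by auto
      from micro_step[OF r, of j] insert.prems
      consider (a) z where "running z (?c(j := Suc (?c j)))"
        | (b) z where "above z (?c(j := Suc (?c j)))" "clocked z ?c" "dotn n a z = 1" by auto
      then show ?thesis
      proof cases
        case a
        then show ?thesis unfolding eq by blast
      next
        case b
        have "above z (\<lambda>_. Suc N)" by (rule above_mono[OF b(1)]) (use insert.hyps in auto)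
        moreover have "clocked z (\<lambda>_. N)" by (rule clocked_mono[OF b(2)]) simp
        ultimately have "finished z N" using b(3) by (simp add: finished_def)
        then show ?thesis by blast
      qed
    qed blast
  qed
qed

lemma run_or_finish:
  assumes "dotn n a x < 1"
  shows "(\<exists>y. running y (\<lambda>_. N)) \<or> (\<exists>y M. finished y M)"
proof (induction N)
  case 0
  have "running x (\<lambda>_. 0)" using assms x by (simp add: running_def above_def clocked_def vle_refl)
  then show ?case by blast
next
  case (Suc N)
  then consider (r) y where "running y (\<lambda>_. N)" | (f) "\<exists>y M. finished y M" by blast
  then show ?case
  proof cases
    case r
    from round_step[OF r subset_refl]
    consider (a) z where "running z (\<lambda>i. if i \<in> S then Suc N else N)" | (b) z where "finished z N" by blast
    then show ?thesis
    proof cases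
      case a
      have "running z (\<lambda>_. Suc N)"
        using a unfolding running_def above_def clocked_def by (simp cong: sum.cong)
      then show ?thesis by blast
    qed blast
  qed blast
qed

text \<open>Every completed round costs at least eps s per coordinate of the row, whereas all points
  with the row uncovered lie below \<open>top\<close>, so their cost is bounded.\<close>

lemma finish:
  assumes ax: "dotn n a x < 1" and ne: "S \<noteq> {}"
  shows "\<exists>y M. finished y M"
proof (rule ccontr)
  assume no: "\<nexists>y M. finished y M"
  define top where "top i = x i + (if i \<in> S then 1 / a i else 0)" for i
  have top: "top \<in> orth n"
    using x by (auto simp: orth_def top_def supp_def)
  define K where "K = F top - F x"
  obtain N :: nat where N: "K / (\<epsilon> * s) < N" using reals_Archimedean2 by blast
  obtain y where y: "running y (\<lambda>_. N)" using run_or_finish[OF ax] no by blast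
  have yo: "y \<in> orth n" and ay: "dotn n a y < 1" and low: "\<epsilon> * s * (card S * real N) \<le> F y - F x"
    using y by (auto simp: running_def above_def)
  have "1 \<le> card S" using ne by (simp add: Suc_le_eq card_gt_0_iff)
  then have "1 * real N \<le> card S * real N" by (intro mult_right_mono) auto
  then have "\<epsilon> * s * N \<le> \<epsilon> * s * (card S * real N)" using eps_pos s_pos by simp
  then have "\<epsilon> * s * N \<le> F y - F x" using low by linarith
  moreover have "K < \<epsilon> * s * N" using N eps_pos s_pos by (simp add: field_simps)
  moreover have "vle y top"
    unfolding vle_def
  proof
    fix i
    show "y i \<le> top i"
    proof (cases "i \<in> S")
      case True
      then have "y i \<le> 1 / a i"
        using coord_le_one[OF yo _ True] ay by (simp add: supp_def field_simps)
      then show ?thesis using True orth_nonneg[OF x, of i] by (simp add: top_def)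
    next
      case False
      then show ?thesis using y by (simp add: top_def running_def above_def)
    qed
  qed
  then have "F y - F x \<le> K" using F_mono[OF yo top] by (simp add: K_def)
  ultimately show False by linarith
qed

end

text \<open>With increments \<open>\<epsilon>\<close> small against the cost of covering the row, at least 15 rounds are
  completed, so the truncated last round costs at most a factor \<open>16/15\<close>.\<close>

lemma (in monotone_cost) row_step_exists:
  assumes x: "x \<in> orth n" and a: "valid_row n a" and ax: "dotn n a x < 1"
  shows "\<exists>z T. z \<in> orth n \<and> vle x z \<and> dotn n a z = 1 \<and> 0 \<le> T \<and> F z - F x \<le> 8/5 * T \<and>
    (\<forall>j\<in>supp n a. \<forall>\<Psi>. clock_fun (a j) (1 / (2 * real (card (supp n a)))) \<Psi> \<longrightarrow>
       T \<le> G z j * (\<Psi> (z j) - \<Psi> (x j)))"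
proof -
  define k where "k = card (supp n a)"
  define s where "s = 1 / (2 * real k)"
  have k: "0 < k" using card_supp_pos[OF a] by (simp add: k_def)
  have s: "0 < s" using k by (simp add: s_def)
  have ao: "a \<in> orth n" using a by (simp add: valid_row_def)
  show ?thesis
  proof (cases "\<exists>j\<in>supp n a. \<forall>x\<in>orth n. \<forall>h\<ge>0. F (x(j := x j + h)) = F x")
    case True
    \<comment> \<open>The row is covered along the free coordinate alone, with duration T =
      0.\<close>
    then obtain j where j: "j \<in> supp n a" and free: "\<forall>x\<in>orth n. \<forall>h\<ge>0. F (x(j := x j + h)) = F x"
      by blast
    have jn: "j < n" and aj: "0 < a j" using j by (auto simp: supp_def)
    define h where "h = (1 - dotn n a x) / a j"
    define z where "z = x(j := x j + h)"
    have h: "0 \<le> h" "a j * h = 1 - dotn n a x" using ax aj by (auto simp: h_def)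
    have z: "z \<in> orth n" using orth_upd[OF x jn] h orth_nonneg[OF x, of j] by (simp add: z_def)
    have xz: "vle x z" using h by (simp add: z_def vle_def)
    have az: "dotn n a z = 1" using dotn_upd[OF jn, of a x h] h by (simp add: z_def)
    have "0 \<le> G z i * (\<Psi> (z i) - \<Psi> (x i))" if i: "i \<in> supp n a" and \<Psi>: "clock_fun (a i) s \<Psi>" for i \<Psi>
    proof -
      have "a i * z i \<le> (\<Sum>l\<in>supp n a. a l * z l)"
        using i ao z by (intro member_le_sum) (auto simp: orth_nonneg)
      then have "a i * z i \<le> 1" using az dotn_supp[OF ao, of z] by simp
      then have "\<Psi> (x i) \<le> \<Psi> (z i)"
        using clock_fun_mono[OF \<Psi>] s i xz x by (simp add: supp_def vle_def orth_nonneg)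
      then show ?thesis using G_nonneg[OF z] by simp
    qed
    moreover have "F z = F x" using free x h by (simp add: z_def)
    ultimately show ?thesis
      using z xz az unfolding s_def k_def by (intro exI[of _ z] exI[of _ 0]) auto
  next
    case False
    then have strict: "F y < F (y(j := y j + h))" if "j \<in> supp n a" "y \<in> orth n" "0 < h" for j y h
      using free_or_strict[of j] that unfolding supp_def by blast
    define \<Delta> where "\<Delta> j = (1 - dotn n a x) / (k * a j)" for j
    have \<Delta>: "0 < \<Delta> j" if "j \<in> supp n a" for j
      using that ax k by (auto simp: \<Delta>_def supp_def)
    \<comment> \<open>Some coordinate must rise by \<open>\<Delta> j\<close>, its equal share of the
      missing coverage, so c is a lower bound on the cost of any way to cover the row. With quantum
      c / 24 and rate sum 1 + k * 1 / (2k) = 3/2, a round costs at most c / 16; hence N + 1 >=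
      16.\<close>
    define c where "c = Min ((\<lambda>j. F (x(j := x j + \<Delta> j)) - F x) ` supp n a)"
    have ne: "supp n a \<noteq> {}" using k by (auto simp: k_def)
    have c_le: "c \<le> F (x(j := x j + \<Delta> j)) - F x" if "j \<in> supp n a" for j
      using that unfolding c_def by (intro Min_le) auto
    have c: "0 < c" using strict[OF _ x \<Delta>] ne unfolding c_def by (subst Min_gr_iff) auto
    interpret row_step n F G a x s "c / 24"
      using ao x s c strict by unfold_locales auto
    obtain z N where fin: "finished z N" using finish[OF ax ne] by blast
    have z: "z \<in> orth n" "vle x z" and az: "dotn n a z = 1" and cl: "clocked z (\<lambda>_. N)"
      and cost: "F z - F x \<le> c / 24 * (\<Sum>j\<in>S. Suc N * (a j * z j + s))"
      using fin by (auto simp: finished_def above_def)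
    have "(\<Sum>j\<in>S. Suc N * (a j * z j + s)) = Suc N * ((\<Sum>j\<in>S. a j * z j) + k * s)"
      by (simp only: sum_distrib_left[symmetric] sum.distrib) (simp add: k_def)
    also have "\<dots> = Suc N * (3/2)"
      using az dotn_supp[OF ao, of z] k by (simp add: s_def)
    finally have cost': "F z - F x \<le> c / 16 * Suc N" using cost by (simp only:)
    have "\<exists>j\<in>S. \<Delta> j \<le> z j - x j"
    proof (rule ccontr)
      assume "\<not> ?thesis"
      then have "a j * (z j - x j) < a j * \<Delta> j" if "j \<in> S" for j
        using that by (auto simp: supp_def not_le)
      then have "(\<Sum>j\<in>S. a j * (z j - x j)) < (\<Sum>j\<in>S. a j * \<Delta> j)"
        using ne by (intro sum_strict_mono) auto
      also have "\<dots> = (\<Sum>j\<in>S. (1 - dotn n a x) / k)"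
        by (intro sum.cong) (auto simp: \<Delta>_def supp_def)
      also have "\<dots> = 1 - dotn n a x" using ne by (simp add: k_def)
      finally show False
        using az by (simp add: dotn_supp[OF ao] right_diff_distrib sum_subtractf)
    qed
    then obtain j where j: "j \<in> S" "\<Delta> j \<le> z j - x j" by blast
    have "F (x(j := x j + \<Delta> j)) \<le> F z"
    proof (rule F_mono[OF _ z(1)])
      show "x(j := x j + \<Delta> j) \<in> orth n"
        using orth_upd[OF x] j \<Delta>[OF j(1)] orth_nonneg[OF x, of j] by (simp add: supp_def)
      show "vle (x(j := x j + \<Delta> j)) z" using j z by (simp add: vle_def)
    qed
    then have "c \<le> c / 16 * Suc N" using c_le[OF j(1)] cost' by linarith
    then have "15 \<le> real N" using c by (simp add: field_simps)
    then have "Suc N / 16 \<le> 8/5 * (N / 24)" by simp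
    then have "c * (Suc N / 16) \<le> c * (8/5 * (N / 24))" using c by (intro mult_left_mono) auto
    then have "F z - F x \<le> 8/5 * (N * (c / 24))" using cost' by simp
    moreover have "\<forall>j\<in>supp n a. \<forall>\<Psi>. clock_fun (a j) s \<Psi> \<longrightarrow>
        N * (c / 24) \<le> G z j * (\<Psi> (z j) - \<Psi> (x j))"
      using cl unfolding clocked_def by blast
    moreover have "0 \<le> N * (c / 24)" using c by simp
    ultimately show ?thesis using z az unfolding s_def k_def by blast
  qed
qed

section \<open>The potential of a comparison solution\<close>

text \<open>The cut at \<open>pot_cut D\<close> is harmless: coordinates with
  \<open>a\<^sub>j \<xi>\<^sub>j < 1 / pot_cut D\<close> contribute at most \<open>1/5\<close> (nothing, if \<open>D = 1\<close>) to \<open>a \<xi> \<ge> 1\<close>.\<close>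

definition pot_cut :: "nat \<Rightarrow> real" where
  "pot_cut D = (if D \<le> 1 then 1 else 5 * D)"

text \<open>Makes \<open>relevant_coordinates\<close> deliver 8/5 = (3/2) * (16/15), the cost factor
  of a row. For D >= 2 the coordinates surviving the cut give at least 4/5, so the weight is
  2.\<close>

definition pot_weight :: "nat \<Rightarrow> real" where
  "pot_weight D = (if D \<le> 1 then 8/5 else 2)"

text \<open>Division by 0 yields 0, so a coordinate with xi = 0 carries no potential.\<close>

definition pot :: "nat \<Rightarrow> real \<Rightarrow> real \<Rightarrow> real" where
  "pot D \<xi> y = pot_weight D * ln (1 + 2 * real D * min (y / \<xi>) (pot_cut D))"

lemma pot_cut_ge_1: "1 \<le> pot_cut D"
  unfolding pot_cut_def by auto

lemma pot_weight_pos: "0 < pot_weight D"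
  unfolding pot_weight_def by auto

lemma pot_0 [simp]: "pot D \<xi> 0 = 0"
  using pot_cut_ge_1[of D] unfolding pot_def by simp

lemma pot_mono:
  assumes "0 \<le> \<xi>" "0 \<le> y" "y \<le> z"
  shows "pot D \<xi> y \<le> pot D \<xi> z"
proof -
  have yz: "0 \<le> y / \<xi>" "y / \<xi> \<le> z / \<xi>" using assms by (auto intro: divide_right_mono)
  then have m: "0 \<le> min (y / \<xi>) (pot_cut D)" "min (y / \<xi>) (pot_cut D) \<le> min (z / \<xi>) (pot_cut D)"
    using pot_cut_ge_1[of D] by auto
  then have "2 * real D * min (y / \<xi>) (pot_cut D) \<le> 2 * real D * min (z / \<xi>) (pot_cut D)"
    by (intro mult_left_mono) auto
  moreover have "0 \<le> 2 * real D * min (y / \<xi>) (pot_cut D)" using m by simp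
  ultimately show ?thesis
    unfolding pot_def using pot_weight_pos[of D]
    by (intro mult_left_mono) auto
qed

lemma pot_nonneg: "0 \<le> \<xi> \<Longrightarrow> 0 \<le> y \<Longrightarrow> 0 \<le> pot D \<xi> y"
  using pot_mono[of \<xi> 0 y D] by simp

text \<open>For D >= 2 the argument of the logarithm is at most 1 + 10 D^2 <= 5 (1 + 2 D^2), and 5^4
  <= 9^3 gives ln 5 <= (3/4) ln 9 <= (3/4) ln (1 + 2 D^2). The weight 2 then yields 2 (1 + 3/4) =
  7/2.\<close>

lemma pot_le:
  assumes D: "1 \<le> D" and "0 \<le> \<xi>" "0 \<le> y"
  shows "pot D \<xi> y \<le> 7/2 * ln (1 + 2 * (real D)^2)"
proof -
  have pos: "0 \<le> 2 * real D * min (y / \<xi>) (pot_cut D)"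
    using assms pot_cut_ge_1[of D] by simp
  have "2 * real D * min (y / \<xi>) (pot_cut D) \<le> 2 * real D * pot_cut D"
    by (intro mult_left_mono) auto
  then have 1: "pot D \<xi> y \<le> pot_weight D * ln (1 + 2 * real D * pot_cut D)"
    unfolding pot_def using pos pot_weight_pos[of D] by (intro mult_left_mono) auto
  show ?thesis
  proof (cases "D = 1")
    case True
    have "pot D \<xi> y \<le> 8/5 * ln 3" using 1 True by (simp add: pot_weight_def pot_cut_def)
    also have "\<dots> \<le> 7/2 * ln 3" by (intro mult_right_mono) auto
    finally show ?thesis using True by simp
  next
    case False
    then have D2: "2 \<le> real D" using D by simp
    have "4 \<le> (real D)^2" using power_mono[OF D2, of 2] by simp
    have L: "0 < 1 + 2 * (real D)^2" by (simp add: add_pos_nonneg)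
    have "4 * ln 5 = ln (5^4 :: real)" by (subst ln_realpow) auto
    also have "\<dots> \<le> ln (9^3 :: real)" by simp
    also have "\<dots> = 3 * ln 9" by (subst ln_realpow) auto
    also have "ln 9 \<le> ln (1 + 2 * (real D)^2)" using \<open>4 \<le> (real D)^2\<close> by simp
    finally have 5: "ln 5 \<le> 3/4 * ln (1 + 2 * (real D)^2)" by simp
    have "1 + 2 * real D * pot_cut D \<le> 5 * (1 + 2 * (real D)^2)"
      using False D by (simp add: pot_cut_def power2_eq_square)
    then have "ln (1 + 2 * real D * pot_cut D) \<le> ln (5 * (1 + 2 * (real D)^2))"
      using pot_cut_ge_1[of D] by (subst ln_le_cancel_iff) (auto intro: add_pos_nonneg)
    also have "\<dots> = ln 5 + ln (1 + 2 * (real D)^2)" using L by (intro ln_mult_pos) auto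
    finally have "2 * ln (1 + 2 * real D * pot_cut D) \<le> 7/2 * ln (1 + 2 * (real D)^2)"
      using 5 by simp
    then show ?thesis using 1 False D by (simp add: pot_weight_def)
  qed
qed

text \<open>With alpha = min (c xi) 1 the derivative is (xi / alpha) / (y + xi / (2 D)), and alpha
  (y + xi / (2 D)) <= xi (c y + s) because alpha <= c xi and alpha <= 1. The cut is inactive where c
  y <= 1. The inequality ln u <= u - 1 turns this into a difference inequality at the right
  endpoint.\<close>

lemma clock_fun_pot:
  assumes \<xi>: "0 < \<xi>" and c: "0 < c" "1 \<le> c * \<xi> * pot_cut D" and D: "1 \<le> D" and s: "1 / (2 * real D) \<le> s"
  shows "clock_fun c s (\<lambda>y. \<xi> / min (c * \<xi>) 1 * ln (1 + 2 * real D * min (y / \<xi>) (pot_cut D)))"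
  unfolding clock_fun_def
proof (intro allI impI)
  fix y z :: real assume yz: "0 \<le> y \<and> y \<le> z \<and> c * z \<le> 1"
  let ?\<alpha> = "min (c * \<xi>) 1"
  have D0: "0 < real D" using D by simp
  have s0: "0 < s" using s D0 by (meson divide_pos_pos less_le_trans mult_pos_pos zero_less_numeral zero_less_one)
  have \<alpha>: "0 < ?\<alpha>" using \<xi> c by simp
  have "c * z \<le> c * (\<xi> * pot_cut D)" using yz c(2) by (simp only: mult.assoc) linarith
  then have "z \<le> \<xi> * pot_cut D" by (rule mult_left_le_imp_le) (rule c(1))
  then have z: "z / \<xi> \<le> pot_cut D" using \<xi> by (simp add: divide_le_eq mult.commute)
  have "y / \<xi> \<le> z / \<xi>" using yz \<xi> by (simp add: divide_right_mono)
  then have mins: "min (z / \<xi>) (pot_cut D) = z / \<xi>" "min (y / \<xi>) (pot_cut D) = y / \<xi>" using z by auto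
  define A where "A = 1 + 2 * real D * (z / \<xi>)"
  define B where "B = 1 + 2 * real D * (y / \<xi>)"
  have AB: "0 < A" "0 < B" unfolding A_def B_def using yz \<xi> D0 by (auto intro!: add_pos_nonneg)
  have "ln (B / A) \<le> B / A - 1" using AB by (intro ln_le_minus_one) simp
  then have "(A - B) / A \<le> ln A - ln B" using AB by (simp add: ln_div field_simps)
  moreover have "(A - B) / A = (z - y) / (z + \<xi> / (2 * real D))"
  proof -
    have "A - B = 2 * D / \<xi> * (z - y)" by (simp add: A_def B_def algebra_simps diff_divide_distrib)
    moreover have "A = 2 * D / \<xi> * (z + \<xi> / (2 * real D))"
      using \<xi> D0 by (simp add: A_def distrib_left)
    ultimately show ?thesis using \<xi> D0 by simp
  qed
  ultimately have 1: "(z - y) / (z + \<xi> / (2 * real D)) \<le> ln A - ln B" by simp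
  have "?\<alpha> * z \<le> c * \<xi> * z" using yz by (intro mult_right_mono) auto
  moreover have "?\<alpha> * (\<xi> / (2 * real D)) \<le> 1 * (\<xi> * s)"
    using \<xi> s \<alpha> D0 by (intro mult_mono) (auto simp: divide_simps)
  ultimately have le: "?\<alpha> * (z + \<xi> / (2 * real D)) \<le> \<xi> * (c * z + s)" by (simp add: algebra_simps)
  have pos: "0 < z + \<xi> / (2 * real D)" "0 < c * z + s"
    using yz \<xi> D0 s0 c by (auto intro!: add_nonneg_pos)
  have "(z - y) / (c * z + s) \<le> \<xi> / ?\<alpha> * ((z - y) / (z + \<xi> / (2 * real D)))"
  proof -
    have "1 / Q \<le> \<xi> / \<alpha> * (1 / P)" if "0 < Q" "0 < \<alpha>" "0 < P" "\<alpha> * P \<le> \<xi> * Q" for Q \<alpha> P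
      using that by (simp add: field_simps)
    from mult_left_mono[OF this[OF pos(2) \<alpha> pos(1) le], of "z - y"] show ?thesis
      using yz by (simp add: ac_simps)
  qed
  also have "\<dots> \<le> \<xi> / ?\<alpha> * (ln A - ln B)"
    using 1 \<xi> \<alpha> by (intro mult_left_mono) auto
  finally show "(z - y) / (c * z + s) \<le> \<xi> / ?\<alpha> * ln (1 + 2 * real D * min (z / \<xi>) (pot_cut D))
      - \<xi> / ?\<alpha> * ln (1 + 2 * real D * min (y / \<xi>) (pot_cut D))"
    unfolding mins A_def B_def by (simp add: right_diff_distrib)
qed

text \<open>A coordinate with a_j xi_j >= 1 suffices alone. Without one, the minima are the products
  themselves, D is at least 2, and the at most D coordinates that are cut lose less than 1 / (5 D)
  each.\<close>

lemma relevant_coordinates: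
  assumes a: "a \<in> orth n" and \<xi>: "\<xi> \<in> orth n" "1 \<le> dotn n a \<xi>" and D: "card (supp n a) \<le> D" "1 \<le> D"
  shows "8/5 \<le> pot_weight D *
    (\<Sum>j | j \<in> supp n a \<and> 1 \<le> a j * \<xi> j * pot_cut D. min (a j * \<xi> j) 1)"
proof -
  let ?S = "supp n a"
  let ?R = "{j. j \<in> ?S \<and> 1 \<le> a j * \<xi> j * pot_cut D}"
  have fin: "finite ?R" by (rule finite_subset[of _ ?S]) auto
  have nn: "0 \<le> min (a j * \<xi> j) 1" for j using a \<xi> by (auto simp: orth_nonneg)
  have sum1: "1 \<le> (\<Sum>j\<in>?S. a j * \<xi> j)" using \<xi> dotn_supp[OF a] by simp
  have one: "1 \<le> (\<Sum>j\<in>?R. min (a j * \<xi> j) 1)" if j: "j \<in> ?S" "1 \<le> a j * \<xi> j" for j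
  proof -
    have "1 * 1 \<le> a j * \<xi> j * pot_cut D" using j pot_cut_ge_1[of D] by (intro mult_mono) auto
    then have "min (a j * \<xi> j) 1 \<le> (\<Sum>j\<in>?R. min (a j * \<xi> j) 1)"
      using j fin nn by (intro member_le_sum) auto
    then show ?thesis using j by simp
  qed
  have key: "8/5 \<le> pot_weight D * 1" by (simp add: pot_weight_def)
  show ?thesis
  proof (cases "\<exists>j\<in>?S. 1 \<le> a j * \<xi> j")
    case True
    then have "pot_weight D * 1 \<le> pot_weight D * (\<Sum>j\<in>?R. min (a j * \<xi> j) 1)"
      using one pot_weight_pos[of D] by (intro mult_left_mono) auto
    then show ?thesis using key by linarith
  next
    case False
    then have lt: "a j * \<xi> j < 1" if "j \<in> ?S" for j using that by force
    have "?S \<noteq> {}" using sum1 by auto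
    have D2: "2 \<le> D"
    proof (rule ccontr)
      assume "\<not> 2 \<le> D"
      then have "card ?S = 1" using D \<open>?S \<noteq> {}\<close> by (simp add: order.antisym Suc_le_eq card_gt_0_iff)
      then obtain j where "?S = {j}" by (auto simp: card_1_singleton_iff)
      then show False using sum1 lt[of j] by simp
    qed
    have "(\<Sum>j\<in>?S - ?R. a j * \<xi> j) \<le> (\<Sum>j\<in>?S - ?R. 1 / (5 * D))"
      using D2 by (intro sum_mono) (auto simp: pot_cut_def field_simps)
    also have "\<dots> = card (?S - ?R) / (5 * D)" by simp
    also have "\<dots> \<le> 1 / 5"
    proof -
      have "card (?S - ?R) \<le> D" using D card_mono[of ?S "?S - ?R"] by simp
      then show ?thesis using D2 by (simp add: field_simps)
    qed
    finally have small: "(\<Sum>j\<in>?S - ?R. a j * \<xi> j) \<le> 1/5" .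
    have "(\<Sum>j\<in>?S. a j * \<xi> j) = (\<Sum>j\<in>?S - ?R. a j * \<xi> j) + (\<Sum>j\<in>?R. a j * \<xi> j)"
      by (intro sum.subset_diff) auto
    moreover have "(\<Sum>j\<in>?R. a j * \<xi> j) = (\<Sum>j\<in>?R. min (a j * \<xi> j) 1)"
      using lt by (intro sum.cong) (auto simp: min_def order.strict_iff_order)
    ultimately have "4/5 \<le> (\<Sum>j\<in>?R. min (a j * \<xi> j) 1)" using small sum1 by linarith
    then show ?thesis using D2 by (simp add: pot_weight_def)
  qed
qed

section \<open>Charging moves to a comparison solution\<close>

definition growth :: "nat \<Rightarrow> nat \<Rightarrow> vec \<Rightarrow> vec \<Rightarrow> vec \<Rightarrow> vec \<Rightarrow> real" where
  "growth n D \<xi> w x z = (\<Sum>j<n. \<xi> j * w j * (pot D (\<xi> j) (z j) - pot D (\<xi> j) (x j)))"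

text \<open>Leaving x fixed when the row is already covered is what freezes the cost after a
  feasible advice has been bought.\<close>

definition covering_move :: "nat \<Rightarrow> (vec \<Rightarrow> real) \<Rightarrow> (vec \<Rightarrow> vec) \<Rightarrow> vec \<Rightarrow> vec \<Rightarrow> vec \<Rightarrow> bool" where
  "covering_move n F G a x z \<longleftrightarrow> z \<in> orth n \<and> vle x z \<and> 1 \<le> dotn n a z \<and>
     (1 \<le> dotn n a x \<longrightarrow> z = x) \<and>
     (\<forall>D \<xi>. card (supp n a) \<le> D \<longrightarrow> \<xi> \<in> orth n \<longrightarrow> 1 \<le> dotn n a \<xi> \<longrightarrow>
        F z - F x \<le> growth n D \<xi> (G z) x z)"

lemma growth_self [simp]: "growth n D \<xi> w x x = 0"
  unfolding growth_def by simp

text \<open>On each relevant coordinate the duration T becomes at least min (a_j xi_j) 1 * T of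
  potential before weighting. The weighted sum is at least 8/5 * T, the bound on the cost of the
  move.\<close>

lemma (in monotone_cost) covering_move_exists:
  assumes x: "x \<in> orth n" and a: "valid_row n a"
  shows "\<exists>z. covering_move n F G a x z"
proof (cases "1 \<le> dotn n a x")
  case True
  then show ?thesis
    using x by (intro exI[of _ x]) (simp add: covering_move_def vle_refl)
next
  case False
  let ?S = "supp n a"
  have ao: "a \<in> orth n" using a by (simp add: valid_row_def)
  obtain z T where z: "z \<in> orth n" "vle x z" and az: "dotn n a z = 1" and T: "0 \<le> T"
    and cost: "F z - F x \<le> 8/5 * T"
    and clock: "\<forall>j\<in>?S. \<forall>\<Psi>. clock_fun (a j) (1 / (2 * real (card ?S))) \<Psi> \<longrightarrow>
       T \<le> G z j * (\<Psi> (z j) - \<Psi> (x j))"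
    using row_step_exists[OF x a] False by auto
  have "F z - F x \<le> growth n D \<xi> (G z) x z"
    if D: "card ?S \<le> D" and \<xi>: "\<xi> \<in> orth n" "1 \<le> dotn n a \<xi>" for D \<xi>
  proof -
    let ?R = "{j. j \<in> ?S \<and> 1 \<le> a j * \<xi> j * pot_cut D}"
    have k: "0 < card ?S" using card_supp_pos[OF a] .
    have D1: "1 \<le> D" using D k by simp
    have s: "1 / (2 * real D) \<le> 1 / (2 * real (card ?S))"
      using D k by (intro divide_left_mono) auto
    have nn: "0 \<le> \<xi> j * G z j * (pot D (\<xi> j) (z j) - pot D (\<xi> j) (x j))" for j
      using \<xi> z x pot_mono[of "\<xi> j" "x j" "z j" D] G_nonneg[OF z(1)]
      by (intro mult_nonneg_nonneg) (auto simp: orth_nonneg vle_def)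
    have each: "pot_weight D * (min (a j * \<xi> j) 1 * T)
        \<le> \<xi> j * G z j * (pot D (\<xi> j) (z j) - pot D (\<xi> j) (x j))" if j: "j \<in> ?R" for j
    proof -
      let ?l = "\<lambda>y. ln (1 + 2 * real D * min (y / \<xi> j) (pot_cut D))"
      have jS: "j \<in> ?S" and aj: "0 < a j" and cut: "1 \<le> a j * \<xi> j * pot_cut D"
        using j by (auto simp: supp_def)
      have \<xi>j: "0 < \<xi> j" using cut orth_nonneg[OF \<xi>(1), of j] by (cases "\<xi> j = 0") auto
      have \<alpha>: "0 < min (a j * \<xi> j) 1" using aj \<xi>j by simp
      have "T \<le> G z j * (\<xi> j / min (a j * \<xi> j) 1 * ?l (z j) - \<xi> j / min (a j * \<xi> j) 1 * ?l (x j))"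
        using clock jS clock_fun_pot[OF \<xi>j aj cut D1 s] by blast
      also have "\<dots> = G z j * \<xi> j * (?l (z j) - ?l (x j)) / min (a j * \<xi> j) 1"
        by (simp add: diff_divide_distrib algebra_simps)
      finally have "min (a j * \<xi> j) 1 * T \<le> \<xi> j * G z j * (?l (z j) - ?l (x j))"
        using \<alpha> by (simp add: pos_le_divide_eq mult.commute)
      then have "pot_weight D * (min (a j * \<xi> j) 1 * T)
          \<le> pot_weight D * (\<xi> j * G z j * (?l (z j) - ?l (x j)))"
        using pot_weight_pos[of D] by (intro mult_left_mono) auto
      then show ?thesis unfolding pot_def by (simp add: algebra_simps)
    qed
    have "8/5 * T \<le> pot_weight D * (\<Sum>j\<in>?R. min (a j * \<xi> j) 1) * T"
      using relevant_coordinates[OF ao \<xi> D D1] T by (rule mult_right_mono)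
    also have "\<dots> = (\<Sum>j\<in>?R. pot_weight D * (min (a j * \<xi> j) 1 * T))"
      by (simp add: sum_distrib_left sum_distrib_right mult.assoc)
    also have "\<dots> \<le> (\<Sum>j\<in>?R. \<xi> j * G z j * (pot D (\<xi> j) (z j) - pot D (\<xi> j) (x j)))"
      using each by (intro sum_mono) auto
    also have "\<dots> \<le> growth n D \<xi> (G z) x z"
      unfolding growth_def using nn by (intro sum_mono2) (auto simp: supp_def)
    finally show ?thesis using cost by linarith
  qed
  then show ?thesis using z az False unfolding covering_move_def by (intro exI[of _ z]) auto
qed

text \<open>The bound that survives a sequence of moves; \<open>x0\<close> is where the potential starts
  and \<open>e\<close> the part of the cost that is not charged to it.\<close>

definition charged :: "nat \<Rightarrow> (vec \<Rightarrow> real) \<Rightarrow> (vec \<Rightarrow> vec) \<Rightarrow> vec list \<Rightarrow> vec \<Rightarrow> real \<Rightarrow> vec \<Rightarrow> bool" where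
  "charged n F G rs x0 e x \<longleftrightarrow> (\<forall>D \<xi>. (\<forall>a\<in>set rs. card (supp n a) \<le> D) \<longrightarrow> feasible n rs \<xi> \<longrightarrow>
     F x - e \<le> growth n D \<xi> (G x) x0 x)"

text \<open>The potential increases along moves, so replacing an earlier gradient by a larger later
  one only helps. This is why successive charges telescope under the final gradient.\<close>

lemma growth_mono:
  assumes "\<xi> \<in> orth n" "x0 \<in> orth n" "\<And>j. j < n \<Longrightarrow> 0 \<le> w j" "\<And>j. j < n \<Longrightarrow> w j \<le> w' j" "vle x0 x" "vle x z"
  shows "growth n D \<xi> w x0 x + growth n D \<xi> w' x z \<le> growth n D \<xi> w' x0 z"
proof -
  have "\<xi> j * w j * (pot D (\<xi> j) (x j) - pot D (\<xi> j) (x0 j))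
      \<le> \<xi> j * w' j * (pot D (\<xi> j) (x j) - pot D (\<xi> j) (x0 j))" if "j < n" for j
    using assms(3,4)[OF that] assms pot_mono[of "\<xi> j" "x0 j" "x j" D]
    by (intro mult_right_mono mult_left_mono) (auto simp: orth_nonneg vle_def)
  then have "growth n D \<xi> w x0 x \<le> growth n D \<xi> w' x0 x"
    unfolding growth_def by (intro sum_mono) auto
  moreover have "growth n D \<xi> w' x0 x + growth n D \<xi> w' x z = growth n D \<xi> w' x0 z"
    unfolding growth_def sum.distrib[symmetric] by (intro sum.cong) (auto simp: algebra_simps)
  ultimately show ?thesis by linarith
qed

lemma feasible_snoc: "feasible n (rs @ [r]) x \<longleftrightarrow> feasible n rs x \<and> 1 \<le> dotn n r x"
  unfolding feasible_def by auto

lemma (in monotone_cost) charged_snoc: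
  assumes ch: "charged n F G rs x0 e x" and x: "x0 \<in> orth n" "x \<in> orth n" "vle x0 x"
    and mv: "covering_move n F G r x z"
  shows "charged n F G (rs @ [r]) x0 e z"
  unfolding charged_def
proof (intro allI impI)
  fix D \<xi> assume D: "\<forall>a\<in>set (rs @ [r]). card (supp n a) \<le> D" and \<xi>: "feasible n (rs @ [r]) \<xi>"
  have z: "z \<in> orth n" "vle x z" using mv by (auto simp: covering_move_def)
  have "F x - e \<le> growth n D \<xi> (G x) x0 x"
    using ch D \<xi> by (simp add: charged_def feasible_snoc)
  moreover have "F z - F x \<le> growth n D \<xi> (G z) x z"
    using mv D \<xi> by (auto simp: covering_move_def feasible_snoc feasible_def)
  moreover have "growth n D \<xi> (G x) x0 x + growth n D \<xi> (G z) x z \<le> growth n D \<xi> (G z) x0 z"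
    using \<xi> x z G_nonneg[OF x(2)] G_mono[OF x(2) z]
    by (intro growth_mono) (auto simp: feasible_def)
  ultimately show "F z - e \<le> growth n D \<xi> (G z) x0 z" by linarith
qed

lemma growth_le:
  assumes "1 \<le> D" "\<xi> \<in> orth n" "x0 \<in> orth n" "x \<in> orth n" "\<And>j. j < n \<Longrightarrow> 0 \<le> w j"
  shows "growth n D \<xi> w x0 x \<le> 7/2 * ln (1 + 2 * (real D)^2) * dotn n \<xi> w"
proof -
  have "growth n D \<xi> w x0 x \<le> (\<Sum>j<n. \<xi> j * w j * (7/2 * ln (1 + 2 * (real D)^2)))"
    unfolding growth_def
  proof (intro sum_mono mult_left_mono)
    fix j assume "j \<in> {..<n}"
    then show "0 \<le> \<xi> j * w j" using assms by (simp add: orth_nonneg)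
    have "0 \<le> \<xi> j" "0 \<le> x0 j" "0 \<le> x j" using assms by (auto simp: orth_nonneg)
    then show "pot D (\<xi> j) (x j) - pot D (\<xi> j) (x0 j) \<le> 7/2 * ln (1 + 2 * (real D)^2)"
      using pot_le[OF assms(1), of "\<xi> j" "x j"] pot_nonneg[of "\<xi> j" "x0 j" D] by linarith
  qed
  also have "\<dots> = 7/2 * ln (1 + 2 * (real D)^2) * dotn n \<xi> w"
    unfolding dotn_def sum_distrib_left by (intro sum.cong) auto
  finally show ?thesis .
qed

section \<open>Convex costs of bounded growth\<close>

lemma normn_scale: "normn n (\<lambda>i. t * h i) = \<bar>t\<bar> * normn n h"
  unfolding normn_def by (simp add: power_mult_distrib sum_distrib_left[symmetric] real_sqrt_mult)

lemma normn_nonneg: "0 \<le> normn n h"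
  unfolding normn_def by (simp add: sum_nonneg)

lemma dotn_scale: "dotn n w (\<lambda>i. t * h i) = t * dotn n w h"
  unfolding dotn_def by (simp add: sum_distrib_left mult.left_commute)

lemma dotn_commute: "dotn n x y = dotn n y x"
  unfolding dotn_def by (simp add: mult.commute)

lemma dotn_diff: "dotn n w (\<lambda>i. x i - y i) = dotn n w x - dotn n w y"
  unfolding dotn_def by (simp add: right_diff_distrib sum_subtractf)

lemma dotn_fun_upd:
  assumes "j < n"
  shows "dotn n w (\<lambda>i. (x(j := v)) i - x i) = w j * (v - x j)"
proof -
  have "dotn n w (\<lambda>i. (x(j := v)) i - x i) = (\<Sum>i<n. if i = j then w j * (v - x j) else 0)"
    unfolding dotn_def by (intro sum.cong) auto
  then show ?thesis using assms by simp
qed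

abbreviation (input) vadd :: "vec \<Rightarrow> vec \<Rightarrow> vec" where
  "vadd x y \<equiv> \<lambda>i. x i + y i"

abbreviation (input) vscale :: "real \<Rightarrow> vec \<Rightarrow> vec" where
  "vscale s x \<equiv> \<lambda>i. s * x i"

lemma derivative_along_line:
  assumes seg: "\<And>u. u \<in> A \<Longrightarrow> vadd y (vscale u v) \<in> orth n" and s: "s \<in> A"
    and grad: "has_grad_orth n f w (vadd y (vscale s v))"
  shows "((\<lambda>u. f (vadd y (vscale u v))) has_real_derivative dotn n w v) (at s within A)"
  unfolding has_field_derivative_iff Lim_within
proof (intro allI impI)
  fix e :: real assume e: "0 < e"
  \<comment> \<open>The summand 1 covers the direction 0.\<close>
  define M where "M = normn n v + 1"
  have M: "0 < M" "normn n v < M" using normn_nonneg[of n v] by (auto simp: M_def)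
  have eM: "0 < e / M" using e M by simp
  obtain \<delta> where \<delta>: "0 < \<delta>" and lin: "\<And>z. z \<in> orth n \<Longrightarrow> normn n (\<lambda>i. z i - vadd y (vscale s v) i) < \<delta> \<Longrightarrow>
      \<bar>f z - f (vadd y (vscale s v)) - dotn n w (\<lambda>i. z i - vadd y (vscale s v) i)\<bar>
        \<le> e / M * normn n (\<lambda>i. z i - vadd y (vscale s v) i)"
    using grad[unfolded has_grad_orth_def, rule_format, OF eM] by blast
  show "\<exists>d>0. \<forall>u\<in>A. 0 < dist u s \<and> dist u s < d \<longrightarrow>
      dist ((f (vadd y (vscale u v)) - f (vadd y (vscale s v))) / (u - s)) (dotn n w v) < e"
  proof (intro exI[of _ "\<delta> / M"] conjI ballI impI)
    show "0 < \<delta> / M" using \<delta> M by simp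
    fix u assume u: "u \<in> A" "0 < dist u s \<and> dist u s < \<delta> / M"
    have us: "0 < \<bar>u - s\<bar>" "\<bar>u - s\<bar> * M < \<delta>" using u M by (auto simp: dist_real_def field_simps)
    have eq: "(\<lambda>i. vadd y (vscale u v) i - vadd y (vscale s v) i) = vscale (u - s) v"
      by (auto simp: algebra_simps)
    have "\<bar>u - s\<bar> * normn n v \<le> \<bar>u - s\<bar> * M" using M by (intro mult_left_mono) auto
    then have "normn n (vscale (u - s) v) < \<delta>" unfolding normn_scale using us(2) by linarith
    then have "\<bar>f (vadd y (vscale u v)) - f (vadd y (vscale s v)) - (u - s) * dotn n w v\<bar>
        \<le> e / M * (\<bar>u - s\<bar> * normn n v)"
      using lin[OF seg[OF u(1)]] unfolding eq normn_scale dotn_scale by simp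
    also have "\<dots> < e * \<bar>u - s\<bar>"
      using e M us by (simp add: field_simps)
    finally have "\<bar>f (vadd y (vscale u v)) - f (vadd y (vscale s v)) - (u - s) * dotn n w v\<bar> / \<bar>u - s\<bar> < e"
      using us by (simp add: divide_less_eq)
    moreover have "(f (vadd y (vscale u v)) - f (vadd y (vscale s v)) - (u - s) * dotn n w v) / (u - s)
        = (f (vadd y (vscale u v)) - f (vadd y (vscale s v))) / (u - s) - dotn n w v"
      using us by (simp add: diff_divide_distrib)
    ultimately show "dist ((f (vadd y (vscale u v)) - f (vadd y (vscale s v))) / (u - s)) (dotn n w v) < e"
      unfolding dist_real_def by (metis abs_divide)
  qed
qed

locale growth_cost =
  fixes n :: nat and f :: "vec \<Rightarrow> real" and g :: "vec \<Rightarrow> vec" and p :: real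
  assumes cvx: "convex_orth n f" and mono: "mono_orth n f"
    and nonneg: "x \<in> orth n \<Longrightarrow> 0 \<le> f x" and at_0: "f (\<lambda>_. 0) = 0"
    and g_orth: "x \<in> orth n \<Longrightarrow> g x \<in> orth n"
    and grad: "x \<in> orth n \<Longrightarrow> has_grad_orth n f (g x) x"
    and g_mono: "grad_mono_orth n g"
    and p1: "1 \<le> p" and euler: "x \<in> orth n \<Longrightarrow> dotn n x (g x) \<le> p * f x"
begin

lemma f_mono: "x \<in> orth n \<Longrightarrow> y \<in> orth n \<Longrightarrow> vle x y \<Longrightarrow> f x \<le> f y"
  using mono unfolding mono_orth_def by blast

lemma gradient_below:
  assumes x: "x \<in> orth n" and y: "y \<in> orth n"
  shows "f x + dotn n (g x) (\<lambda>i. y i - x i) \<le> f y"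
proof -
  let ?v = "\<lambda>i. y i - x i"
  have pt: "vadd x (vscale u ?v) = (\<lambda>i. (1 - u) * x i + u * y i)" for u
    by (auto simp: algebra_simps)
  have on: "vadd x (vscale u ?v) \<in> orth n" if "u \<in> {0..1}" for u
    unfolding pt using x y that by (auto simp: orth_def)
  have x0: "vadd x (vscale 0 ?v) = x" by simp
  have "((\<lambda>u. f (vadd x (vscale u ?v))) has_real_derivative dotn n (g x) ?v) (at 0 within {0..1})"
    by (rule derivative_along_line) (use on grad[OF x] in auto)
  then have "((\<lambda>u. (f (vadd x (vscale u ?v)) - f x) / u) \<longlongrightarrow> dotn n (g x) ?v) (at 0 within {0..1})"
    unfolding has_field_derivative_iff by simp
  moreover have "\<forall>\<^sub>F u in at 0 within {0..1}. (f (vadd x (vscale u ?v)) - f x) / u \<le> f y - f x"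
    unfolding eventually_at
  proof (intro exI[of _ 1] conjI ballI impI)
    fix u :: real assume u: "u \<in> {0..1}" "u \<noteq> 0 \<and> dist u 0 < 1"
    have "f (vadd x (vscale u ?v)) \<le> (1 - u) * f x + u * f y"
      unfolding pt using cvx x y u unfolding convex_orth_def by auto
    then show "(f (vadd x (vscale u ?v)) - f x) / u \<le> f y - f x"
      using u by (simp add: field_simps)
  qed simp
  ultimately have "dotn n (g x) ?v \<le> f y - f x"
    by (rule tendsto_upperbound) (simp add: trivial_limit_within islimpt_Icc)
  then show ?thesis by simp
qed

text \<open>The function t^(-p) f (t x) is nonincreasing: its derivative has the sign of <t x, g (t
  x)> - p f (t x).\<close>

lemma f_scale_up:
  assumes x: "x \<in> orth n" and s: "1 \<le> s"
  shows "f (vscale s x) \<le> s powr p * f x"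
proof -
  have der: "((\<lambda>u. f (vscale u x)) has_real_derivative dotn n (g (vscale t x)) x) (at t)" if t: "0 < t" for t
  proof -
    have "((\<lambda>u. f (vadd (\<lambda>_. 0) (vscale u x))) has_real_derivative dotn n (g (vscale t x)) x) (at t within {0<..})"
      by (rule derivative_along_line) (use orth_scale[OF x] grad t in auto)
    then show ?thesis using t by (simp add: at_within_open[OF _ open_greaterThan])
  qed
  have "f (vscale s x) * s powr (-p) \<le> f (vscale 1 x) * 1 powr (-p)"
  proof (rule DERIV_nonpos_imp_nonincreasing[OF s])
    fix t :: real assume t: "1 \<le> t" "t \<le> s"
    let ?D = "f (vscale t x) * (- p * t powr (- p - 1)) + dotn n (g (vscale t x)) x * t powr (- p)"
    have "((\<lambda>t. f (vscale t x) * t powr (-p)) has_real_derivative ?D) (at t)"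
      using t by (auto intro!: derivative_eq_intros der)
    moreover have "?D \<le> 0"
    proof -
      have "t * dotn n (g (vscale t x)) x \<le> p * f (vscale t x)"
        using euler[OF orth_scale[OF x, of t]] t by (simp add: dotn_scale dotn_commute[of n "vscale t x"])
      then have "t powr (-p-1) * (t * dotn n (g (vscale t x)) x - p * f (vscale t x)) \<le> 0"
        by (intro mult_nonneg_nonpos) auto
      moreover have "t powr (-p) = t powr (-p-1) * t"
        using t by (simp add: powr_diff)
      ultimately show ?thesis by (simp add: algebra_simps)
    qed
    ultimately show "\<exists>y. ((\<lambda>t. f (vscale t x) * t powr (-p)) has_real_derivative y) (at t) \<and> y \<le> 0"
      by blast
  qed
  then have "f (vscale s x) / s powr p \<le> f x" by (simp add: powr_minus_divide)
  then show ?thesis using s by (simp add: pos_divide_le_eq mult.commute)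
qed

text \<open>The tangent at z, evaluated at beta y, lies below f (beta y) <= beta^p f y; the term <z,
  g z> is at most p f z. The parameter beta trades the two costs against each other.\<close>

lemma young:
  assumes y: "y \<in> orth n" and z: "z \<in> orth n" and \<beta>: "1 \<le> \<beta>"
  shows "dotn n y (g z) \<le> (\<beta> powr p * f y + (p - 1) * f z) / \<beta>"
proof -
  have "f z + (\<beta> * dotn n y (g z) - dotn n z (g z)) \<le> f (vscale \<beta> y)"
    using gradient_below[OF z orth_scale[OF y, of \<beta>]] \<beta>
    by (simp add: dotn_diff dotn_scale dotn_commute[of n "g z"])
  then have "\<beta> * dotn n y (g z) \<le> \<beta> powr p * f y + (p - 1) * f z"
    using f_scale_up[OF y \<beta>] euler[OF z] by (simp add: algebra_simps)
  then show ?thesis using \<beta> by (simp add: field_simps)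
qed

text \<open>y + z is the convex combination of y / (1 - t) and z / t with weights 1 - t and
  t.\<close>

lemma f_add_le:
  assumes y: "y \<in> orth n" and z: "z \<in> orth n" and t: "0 < t" "t < 1"
  shows "f (vadd y z) \<le> (1 - t) powr (1 - p) * f y + t powr (1 - p) * f z"
proof -
  have scale: "s * f (vscale (1 / s) w) \<le> s powr (1 - p) * f w" if w: "w \<in> orth n" and s: "0 < s" "s < 1" for s w
  proof -
    have "s * f (vscale (1 / s) w) \<le> s * ((1 / s) powr p * f w)"
      using f_scale_up[OF w, of "1 / s"] s by (intro mult_left_mono) auto
    also have "\<dots> = s powr (1 - p) * f w"
      using s by (simp add: powr_diff powr_divide)
    finally show ?thesis .
  qed
  have "f (\<lambda>i. (1 - t) * vscale (1 / (1 - t)) y i + t * vscale (1 / t) z i)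
      \<le> (1 - t) * f (vscale (1 / (1 - t)) y) + t * f (vscale (1 / t) z)"
    by (intro cvx[unfolded convex_orth_def, rule_format] orth_scale y z) (use t in auto)
  also have "(\<lambda>i. (1 - t) * vscale (1 / (1 - t)) y i + t * vscale (1 / t) z i) = vadd y z"
    using t by auto
  finally show ?thesis using scale[OF y, of "1 - t"] scale[OF z, of t] t by simp
qed

lemma f_add_null:
  assumes y: "y \<in> orth n" and z: "z \<in> orth n" "f z = 0"
  shows "f (vadd y z) = f y"
proof (rule antisym)
  have lim: "((\<lambda>t. (1 - t) powr (1 - p) * f y) \<longlongrightarrow> (1 - 0) powr (1 - p) * f y) (at_right 0)"
    by (intro tendsto_intros) auto
  have "\<forall>\<^sub>F t in at_right (0::real). f (vadd y z) \<le> (1 - t) powr (1 - p) * f y"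
    unfolding eventually_at_right_field
    using f_add_le[OF y z(1)] z(2) by (intro exI[of _ 1]) auto
  from tendsto_lowerbound[OF lim this] show "f (vadd y z) \<le> f y" by simp
  show "f y \<le> f (vadd y z)"
    using f_mono[OF y orth_add[OF y z(1)]] orth_nonneg[OF z(1)] by (simp add: vle_def)
qed

text \<open>By \<open>f_scale_up\<close>, f vanishes on the whole j-th axis once it vanishes at one
  point of it other than 0, and \<open>f_add_null\<close> carries this to every x. Otherwise the
  j-th partial derivative is positive at height h / 2 on the axis, hence by monotonicity also at x
  raised by h / 2, so the second half of the raise costs something.\<close>

lemma null_or_strict:
  assumes j: "j < n"
  shows "(\<forall>x\<in>orth n. \<forall>h\<ge>0. f (x(j := x j + h)) = f x) \<or>
         (\<forall>x\<in>orth n. \<forall>h>0. f x < f (x(j := x j + h)))"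
proof -
  define u :: "real \<Rightarrow> vec" where "u h = (\<lambda>i. if i = j then h else 0)" for h
  have u: "u h \<in> orth n" if "0 \<le> h" for h using that j by (auto simp: u_def orth_def)
  have sc: "vscale s (u h) = u (s * h)" for s h by (auto simp: u_def)
  have upd: "x(j := x j + h) = vadd x (u h)" for x h by (auto simp: u_def)
  have pos: "f (u h) = 0" if "f (u h') = 0" "0 < h'" "0 < h" for h h'
  proof -
    have "f (u h) \<le> f (u (max 1 (h / h') * h'))"
      using that by (intro f_mono u) (auto simp: u_def vle_def max_def field_simps)
    also have "\<dots> \<le> (max 1 (h / h')) powr p * f (u h')"
      using f_scale_up[OF u[of h'], of "max 1 (h / h')"] that by (simp add: sc)
    finally show ?thesis using that nonneg[OF u[of h]] by simp
  qed
  show ?thesis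
  proof (cases "f (u 1) = 0")
    case True
    have "f (x(j := x j + h)) = f x" if "x \<in> orth n" "0 \<le> h" for x h
    proof (cases "h = 0")
      case False
      then show ?thesis unfolding upd using that pos[OF True, of h] by (intro f_add_null u) auto
    qed simp
    then show ?thesis by blast
  next
    case False
    have "f x < f (x(j := x j + h))" if x: "x \<in> orth n" and h: "0 < h" for x h
    proof -
      have xh: "x(j := x j + h) \<in> orth n" if "0 \<le> h" for h :: real
        using orth_upd[OF x j] orth_nonneg[OF x, of j] that by simp
      have "f (u (h / 2)) \<noteq> 0" using pos[where h = 1 and h' = "h / 2"] False h by auto
      then have "0 < f (u (h / 2))" using nonneg[OF u[of "h / 2"]] h by simp
      moreover have "f (u (h / 2)) + dotn n (g (u (h / 2))) (\<lambda>i. 0 - u (h / 2) i) \<le> 0"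
        using gradient_below[OF u[of "h / 2"] u[of 0]] h at_0 by (simp add: u_def[of 0])
      moreover have "dotn n (g (u (h / 2))) (\<lambda>i. 0 - u (h / 2) i) = - (g (u (h / 2)) j * (h / 2))"
      proof -
        have "dotn n (g (u (h / 2))) (\<lambda>i. 0 - u (h / 2) i)
            = (\<Sum>i<n. if i = j then - (g (u (h / 2)) j * (h / 2)) else 0)"
          unfolding dotn_def by (intro sum.cong) (auto simp: u_def)
        then show ?thesis using j by simp
      qed
      ultimately have "0 < g (u (h / 2)) j * (h / 2)" by linarith
      also have "\<dots> \<le> g (x(j := x j + h / 2)) j * (h / 2)"
        using g_mono u[of "h / 2"] xh[of "h / 2"] h j x unfolding grad_mono_orth_def
        by (intro mult_right_mono) (auto simp: vle_def u_def orth_nonneg)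
      finally have "f (x(j := x j + h / 2)) < f (x(j := x j + h / 2))
          + dotn n (g (x(j := x j + h / 2))) (\<lambda>i. (x(j := x j + h)) i - (x(j := x j + h / 2)) i)"
        using dotn_fun_upd[OF j, of "g (x(j := x j + h / 2))" "x(j := x j + h / 2)" "x j + h"] by simp
      also have "\<dots> \<le> f (x(j := x j + h))"
        using gradient_below[OF xh[of "h / 2"] xh[of h]] h by simp
      finally have "f (x(j := x j + h / 2)) < f (x(j := x j + h))" .
      moreover have "vle x (x(j := x j + h / 2))" using h by (simp add: vle_def)
      ultimately show ?thesis using f_mono[OF x xh[of "h / 2"]] h by simp
    qed
    then show ?thesis by blast
  qed
qed

lemma shifted_cost:
  assumes y: "y \<in> orth n" and \<theta>: "0 \<le> \<theta>"
  shows "monotone_cost n (\<lambda>x. f x + \<theta> * f (vadd y x)) (\<lambda>x i. g x i + \<theta> * g (vadd y x) i)"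
proof
  fix x z i assume x: "x \<in> orth n" and z: "z \<in> orth n" and xz: "vle x z"
  have yx: "vadd y x \<in> orth n" "vadd y z \<in> orth n" "vle (vadd y x) (vadd y z)"
    using orth_add[OF y] x z xz by (auto simp: vle_def)
  show "f x + \<theta> * f (vadd y x) \<le> f z + \<theta> * f (vadd y z)"
    using f_mono[OF x z xz] f_mono[OF yx] \<theta> by (intro add_mono mult_left_mono) auto
  assume i: "i < n"
  have "g x i \<le> g z i" "g (vadd y x) i \<le> g (vadd y z) i"
    using g_mono x z xz yx i unfolding grad_mono_orth_def by blast+
  then show "g x i + \<theta> * g (vadd y x) i \<le> g z i + \<theta> * g (vadd y z) i"
    using \<theta> by (intro add_mono mult_left_mono) auto
next
  fix x i assume "x \<in> orth n"
  then show "0 \<le> g x i + \<theta> * g (vadd y x) i"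
    using g_orth[of x] g_orth[OF orth_add[OF y, of x]] \<theta> by (simp add: orth_nonneg)
next
  fix x j and h :: real assume x: "x \<in> orth n" and j: "j < n" and h: "0 \<le> h"
  have upd: "vadd y (x(j := x j + h)) = (vadd y x)(j := vadd y x j + h)" by auto
  have "f (x(j := x j + h)) - f x \<le> g (x(j := x j + h)) j * h" if x: "x \<in> orth n" for x
  proof -
    have "x(j := x j + h) \<in> orth n" using orth_upd[OF x j] orth_nonneg[OF x, of j] h by simp
    from gradient_below[OF this x] show ?thesis
      using dotn_fun_upd[OF j, of "g (x(j := x j + h))" "x(j := x j + h)" "x j"] by simp
  qed
  from this[OF x] this[OF orth_add[OF y x]]
  have "f (x(j := x j + h)) - f x \<le> g (x(j := x j + h)) j * h"
    "\<theta> * (f (vadd y (x(j := x j + h))) - f (vadd y x)) \<le> \<theta> * (g (vadd y (x(j := x j + h))) j * h)"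
    using \<theta> unfolding upd by (auto intro: mult_left_mono)
  then show "f (x(j := x j + h)) + \<theta> * f (vadd y (x(j := x j + h))) - (f x + \<theta> * f (vadd y x))
      \<le> (g (x(j := x j + h)) j + \<theta> * g (vadd y (x(j := x j + h))) j) * h"
    by (simp add: algebra_simps)
next
  fix x j assume x: "x \<in> orth n" and j: "j < n"
  have "continuous_on {0..} (\<lambda>h. f (w(j := w j + h)))" if w: "w \<in> orth n" for w
  proof -
    define v :: vec where "v = (\<lambda>i. if i = j then 1 else 0)"
    have eq: "w(j := w j + h) = vadd w (vscale h v)" for h by (auto simp: v_def)
    have on: "vadd w (vscale h v) \<in> orth n" if "h \<in> {0..}" for h
      using w j that by (auto simp: v_def orth_def)
    show ?thesis
      unfolding eq by (rule DERIV_continuous_on, rule derivative_along_line[OF on _ grad[OF on]])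
  qed
  from this[OF x] this[OF orth_add[OF y x]]
  have "continuous_on {0..} (\<lambda>h. f (x(j := x j + h)))"
    "continuous_on {0..} (\<lambda>h. f ((vadd y x)(j := vadd y x j + h)))" by auto
  moreover have "(vadd y x)(j := vadd y x j + h) = vadd y (x(j := x j + h))" for h by auto
  ultimately show "continuous_on {0..} (\<lambda>h. f (x(j := x j + h)) + \<theta> * f (vadd y (x(j := x j + h))))"
    by (intro continuous_intros) auto
next
  fix j assume j: "j < n"
  have upd: "vadd y (x(j := x j + h)) = (vadd y x)(j := vadd y x j + h)" for x h by auto
  from null_or_strict[OF j]
  show "(\<forall>x\<in>orth n. \<forall>h\<ge>0. f (x(j := x j + h)) + \<theta> * f (vadd y (x(j := x j + h))) = f x + \<theta> * f (vadd y x)) \<or>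
    (\<forall>x\<in>orth n. \<forall>h>0. f x + \<theta> * f (vadd y x) < f (x(j := x j + h)) + \<theta> * f (vadd y (x(j := x j + h))))"
  proof
    assume null: "\<forall>x\<in>orth n. \<forall>h\<ge>0. f (x(j := x j + h)) = f x"
    have "f (vadd y (x(j := x j + h))) = f (vadd y x)" if "x \<in> orth n" "0 \<le> h" for x h
      using null[rule_format, OF orth_add[OF y that(1)] that(2)] unfolding upd by simp
    then show ?thesis using null by (intro disjI1) auto
  next
    assume st: "\<forall>x\<in>orth n. \<forall>h>0. f x < f (x(j := x j + h))"
    show ?thesis
    proof (intro disjI2 ballI allI impI)
      fix x and h :: real assume "x \<in> orth n" "0 < h"
      then have "f x < f (x(j := x j + h))" "f (vadd y x) \<le> f (vadd y (x(j := x j + h)))"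
        unfolding upd using st orth_add[OF y, of x] by (auto simp: less_imp_le)
      then show "f x + \<theta> * f (vadd y x) < f (x(j := x j + h)) + \<theta> * f (vadd y (x(j := x j + h)))"
        using \<theta> by (intro add_less_le_mono mult_left_mono) auto
    qed
  qed
qed

lemma plain_cost: "monotone_cost n f g"
  using shifted_cost[of "\<lambda>_. 0" 0] by (simp add: orth_def)

end

section \<open>Online construction from invariants\<close>

primrec rev_run :: "(vec list \<Rightarrow> vec \<Rightarrow> vec \<Rightarrow> vec) \<Rightarrow> vec \<Rightarrow> vec list \<Rightarrow> vec" where
  "rev_run s x0 [] = x0"
| "rev_run s x0 (r # q) = s (rev q) r (rev_run s x0 q)"

text \<open>The next point is chosen from the revealed rows and the current point alone, so the
  result is a single function of the list of rows, consistent along prefixes. An algorithm can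
  therefore be given by an invariant and an existential step.\<close>

lemma online_from_invariant:
  fixes Inv :: "vec list \<Rightarrow> vec \<Rightarrow> bool"
  assumes start: "Inv [] x0"
    and step: "\<And>rs r x. \<forall>a\<in>set rs. V a \<Longrightarrow> Inv rs x \<Longrightarrow> V r \<Longrightarrow> \<exists>z. Inv (rs @ [r]) z \<and> vle x z"
  shows "\<exists>A. \<forall>rs. (\<forall>a\<in>set rs. V a) \<longrightarrow>
    Inv rs (A rs) \<and> (\<forall>r. V r \<longrightarrow> vle (A rs) (A (rs @ [r])))"
proof -
  define s where "s rs r x = (SOME z. Inv (rs @ [r]) z \<and> vle x z)" for rs :: "vec list" and r x :: vec
  define A where "A rs = rev_run s x0 (rev rs)" for rs
  have A_snoc: "A (rs @ [r]) = s rs r (A rs)" for rs r by (simp add: A_def)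
  have s: "Inv (rs @ [r]) (s rs r x) \<and> vle x (s rs r x)" if "\<forall>a\<in>set rs. V a" "Inv rs x" "V r" for rs r x
    unfolding s_def by (rule someI_ex[OF step[OF that]])
  have "Inv rs (A rs)" if "\<forall>a\<in>set rs. V a" for rs
    using that
  proof (induction rs rule: rev_induct)
    case Nil
    then show ?case using start by (simp add: A_def)
  next
    case (snoc r rs)
    then show ?case using s[of rs "A rs" r] by (simp add: A_snoc)
  qed
  then show ?thesis using s A_snoc by (intro exI[of _ A]) simp
qed

section \<open>Sparsity of the revealed rows\<close>

definition max_sparsity :: "nat \<Rightarrow> vec list \<Rightarrow> nat" where
  "max_sparsity n rs = Max (insert 1 ((\<lambda>a. card (supp n a)) ` set rs))"

lemma max_sparsity_ge_1: "1 \<le> max_sparsity n rs"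
  unfolding max_sparsity_def by (rule Max_ge) auto

lemma card_supp_le: "a \<in> set rs \<Longrightarrow> card (supp n a) \<le> max_sparsity n rs"
  unfolding max_sparsity_def by (intro Max_ge) auto

lemma max_sparsity_mono: "max_sparsity n rs \<le> max_sparsity n (rs @ [r])"
  unfolding max_sparsity_def by (intro Max_mono) auto

text \<open>Valid rows have nonempty support, so the inserted 1 affects only the empty list.\<close>

lemma max_sparsity_eq:
  assumes "rs \<noteq> []" "\<forall>a\<in>set rs. valid_row n a"
  shows "max_sparsity n rs = row_sparsity n rs"
proof -
  have "1 \<le> Max ((\<lambda>a. card (supp n a)) ` set rs)"
  proof -
    have "1 \<le> card (supp n (hd rs))" using card_supp_pos[of n "hd rs"] assms by simp
    also have "\<dots> \<le> Max ((\<lambda>a. card (supp n a)) ` set rs)" using assms by (intro Max_ge) auto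
    finally show ?thesis .
  qed
  then show ?thesis
    using assms unfolding max_sparsity_def row_sparsity_def supp_def by (subst Max_insert) auto
qed

definition log_sparsity :: "nat \<Rightarrow> vec list \<Rightarrow> real" where
  "log_sparsity n rs = ln (1 + 2 * (real (max_sparsity n rs))^2)"

lemma log_sparsity_ge_1: "1 \<le> log_sparsity n rs"
proof -
  have "exp 1 \<le> (3::real)" using exp_le by simp
  also have "\<dots> \<le> 1 + 2 * (real (max_sparsity n rs))^2"
    using max_sparsity_ge_1[of n rs] by (simp add: one_le_power)
  finally show ?thesis unfolding log_sparsity_def by (subst ln_ge_iff) (auto intro: add_pos_nonneg)
qed

lemma log_sparsity_mono: "log_sparsity n rs \<le> log_sparsity n (rs @ [r])"
  unfolding log_sparsity_def using max_sparsity_mono[of n rs r]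
  by (subst ln_le_cancel_iff) (auto intro!: add_pos_nonneg power_mono)

lemma feasible_mono: "feasible n rs x \<Longrightarrow> \<forall>a\<in>set rs. valid_row n a \<Longrightarrow> y \<in> orth n \<Longrightarrow> vle x y \<Longrightarrow> feasible n rs y"
  unfolding feasible_def valid_row_def using dotn_mono order_trans by blast

lemma covering_move_feasible:
  assumes "covering_move n F G r x z" "feasible n rs w" "vle w x" "\<forall>a\<in>set rs. valid_row n a"
  shows "feasible n (rs @ [r]) z"
proof -
  have z: "z \<in> orth n" "vle w z" "1 \<le> dotn n r z"
    using assms vle_trans by (auto simp: covering_move_def)
  show ?thesis using feasible_mono[OF assms(2,4) z(1,2)] z(3) by (simp add: feasible_snoc)
qed

lemma charged_refl: "charged n F G rs x (F x) x"
  unfolding charged_def by simp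

section \<open>Budgets and comparison with the optimum\<close>

context growth_cost
begin

lemma feasible_exists:
  assumes "\<forall>a\<in>set rs. valid_row n a"
  shows "\<exists>x. feasible n rs x"
  using assms
proof (induction rs rule: rev_induct)
  case Nil
  then show ?case by (intro exI[of _ "\<lambda>_. 0"]) (simp add: feasible_def orth_def)
next
  case (snoc r rs)
  then obtain x where x: "feasible n rs x" by auto
  obtain z where z: "covering_move n f g r x z"
    using monotone_cost.covering_move_exists[OF plain_cost, of x r] snoc.prems x by (auto simp: feasible_def)
  then show ?case using covering_move_feasible[OF z x vle_refl] snoc.prems by auto
qed

lemma OPT_le: "feasible n rs \<xi> \<Longrightarrow> OPT n f rs \<le> f \<xi>"
  unfolding OPT_def using nonneg
  by (intro cINF_lower bdd_belowI[of _ 0]) (auto simp: feasible_def)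

text \<open>\<open>OPT\<close> is an infimum with no minimiser at hand: bounds are proved against
  every feasible xi and then pass to the infimum.\<close>

lemma le_affine_OPT:
  assumes rs: "\<forall>a\<in>set rs. valid_row n a" and v: "0 \<le> v"
    and le: "\<And>\<xi>. feasible n rs \<xi> \<Longrightarrow> l \<le> u + v * f \<xi>"
  shows "l \<le> u + v * OPT n f rs"
proof (cases "v = 0")
  case True
  then show ?thesis using le feasible_exists[OF rs] by auto
next
  case False
  have "(l - u) / v \<le> OPT n f rs"
    unfolding OPT_def
  proof (rule cINF_greatest)
    show "{x. feasible n rs x} \<noteq> {}" using feasible_exists[OF rs] by auto
    fix \<xi> assume "\<xi> \<in> {x. feasible n rs x}"
    then show "(l - u) / v \<le> f \<xi>" using le[of \<xi>] v False by (simp add: field_simps)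
  qed
  then show ?thesis using v False by (simp add: field_simps)
qed

lemma OPT_nonneg:
  assumes "\<forall>a\<in>set rs. valid_row n a"
  shows "0 \<le> OPT n f rs"
  using le_affine_OPT[OF assms, of 1 0 0] nonneg by (simp add: feasible_def)

lemma OPT_mono:
  assumes "\<forall>a\<in>set rs. valid_row n a" "valid_row n r"
  shows "OPT n f rs \<le> OPT n f (rs @ [r])"
  using le_affine_OPT[of "rs @ [r]" 1 "OPT n f rs" 0] OPT_le assms by (auto simp: feasible_snoc)

lemma OPT_Nil: "OPT n f [] = 0"
  using OPT_le[of "[]" "\<lambda>_. 0"] OPT_nonneg[of "[]"] at_0 by (simp add: feasible_def orth_def)

definition budget :: "real \<Rightarrow> vec list \<Rightarrow> real" where
  "budget c rs = (c * p * log_sparsity n rs) powr p * OPT n f rs"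

lemma budget_nonneg: "\<forall>a\<in>set rs. valid_row n a \<Longrightarrow> 0 \<le> budget c rs"
  unfolding budget_def using OPT_nonneg by simp

lemma budget_Nil: "budget c [] = 0"
  unfolding budget_def by (simp add: OPT_Nil)

lemma budget_mono:
  assumes "\<forall>a\<in>set rs. valid_row n a" "valid_row n r" "0 \<le> c"
  shows "budget c rs \<le> budget c (rs @ [r])"
  unfolding budget_def
  using assms log_sparsity_mono[of n rs r] log_sparsity_ge_1[of n rs] p1 OPT_mono[OF assms(1,2)] OPT_nonneg[OF assms(1)]
  by (intro mult_mono powr_mono2 mult_left_mono) auto

lemma charged_le:
  assumes ch: "charged n F G rs x0 e x" and x: "x0 \<in> orth n" "x \<in> orth n"
    and G: "\<And>j. j < n \<Longrightarrow> 0 \<le> G x j" and \<xi>: "feasible n rs \<xi>"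
  shows "F x - e \<le> 7/2 * log_sparsity n rs * dotn n \<xi> (G x)"
proof -
  have "F x - e \<le> growth n (max_sparsity n rs) \<xi> (G x) x0 x"
    using ch \<xi> card_supp_le unfolding charged_def by blast
  also have "\<dots> \<le> 7/2 * log_sparsity n rs * dotn n \<xi> (G x)"
    unfolding log_sparsity_def using \<xi> x G
    by (intro growth_le max_sparsity_ge_1) (auto simp: feasible_def)
  finally show ?thesis .
qed

text \<open>\<open>young\<close> with beta = c p L / m, L the log sparsity. A smaller m shrinks the
  coefficient of f z by the factor m and enlarges that of f xi by m^(1 - p).\<close>

lemma young_charge:
  assumes \<xi>: "feasible n rs \<xi>" and z: "z \<in> orth n" and c: "7/2 \<le> c" and m: "0 < m" "m \<le> 1"
  shows "7/2 * log_sparsity n rs * dotn n \<xi> (g z)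
    \<le> 7 / (2 * c * p) * m * (m powr (-p) * (c * p * log_sparsity n rs) powr p * f \<xi> + (p - 1) * f z)"
proof -
  define L where "L = log_sparsity n rs"
  have L: "1 \<le> L" using log_sparsity_ge_1 by (simp add: L_def)
  define \<beta> where "\<beta> = c * p * L"
  have "1 * 1 \<le> c * p" using c p1 by (intro mult_mono) auto
  then have "1 * 1 \<le> \<beta>" unfolding \<beta>_def using L by (intro mult_mono) auto
  then have \<beta>: "1 \<le> \<beta>" by simp
  have \<beta>m: "1 \<le> \<beta> / m" using \<beta> m by (simp add: le_divide_eq)
  have \<xi>o: "\<xi> \<in> orth n" using \<xi> by (simp add: feasible_def)
  have "7/2 * L * dotn n \<xi> (g z) \<le> 7/2 * L * (((\<beta> / m) powr p * f \<xi> + (p - 1) * f z) / (\<beta> / m))"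
    using young[OF \<xi>o z \<beta>m] L by (intro mult_left_mono) auto
  also have "\<dots> = 7/2 * L / \<beta> * m * ((\<beta> / m) powr p * f \<xi> + (p - 1) * f z)" by simp
  also have "7/2 * L / \<beta> = 7 / (2 * c * p)" using L by (simp add: \<beta>_def)
  also have "(\<beta> / m) powr p = m powr (-p) * \<beta> powr p"
    using \<beta> m by (simp add: powr_divide powr_minus field_simps)
  finally show ?thesis by (simp add: L_def \<beta>_def)
qed

lemma charged_budget:
  assumes rs: "\<forall>a\<in>set rs. valid_row n a" and ch: "charged n f g rs x0 e x"
    and x: "x0 \<in> orth n" "x \<in> orth n" and c: "7/2 \<le> c"
  shows "f x - e \<le> 7 / (2 * c * p) * (budget c rs + (p - 1) * f x)"
proof -
  define k where "k = 7 / (2 * c * p)"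
  have k: "0 \<le> k" using c p1 by (simp add: k_def)
  have "f x - e \<le> k * ((p - 1) * f x) + k * (c * p * log_sparsity n rs) powr p * f \<xi>"
    if \<xi>: "feasible n rs \<xi>" for \<xi>
  proof -
    have "f x - e \<le> 7/2 * log_sparsity n rs * dotn n \<xi> (g x)"
      by (rule charged_le[OF ch x _ \<xi>]) (use g_orth[OF x(2)] in \<open>simp add: orth_nonneg\<close>)
    also have "\<dots> \<le> k * 1 * (1 powr (-p) * (c * p * log_sparsity n rs) powr p * f \<xi> + (p - 1) * f x)"
      unfolding k_def by (rule young_charge[OF \<xi> x(2) c]) auto
    finally show ?thesis by (simp add: algebra_simps)
  qed
  from le_affine_OPT[OF rs _ this] k show ?thesis unfolding budget_def k_def[symmetric] by (simp add: algebra_simps)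
qed

text \<open>A jump is not paid by the potential: its cost is added to the uncharged part, while
  growing gradients and potential preserve the earlier charge.\<close>

lemma charged_jump:
  assumes ch: "charged n f g rs x0 e x" and o: "x0 \<in> orth n" "x \<in> orth n" "y \<in> orth n"
    and le: "vle x0 x" "vle x y"
  shows "charged n f g rs x0 (e + (f y - f x)) y"
  unfolding charged_def
proof (intro allI impI)
  fix D \<xi> assume D: "\<forall>a\<in>set rs. card (supp n a) \<le> D" and \<xi>: "feasible n rs \<xi>"
  have \<xi>o: "\<xi> \<in> orth n" using \<xi> by (simp add: feasible_def)
  have gle: "g x j \<le> g y j" if "j < n" for j
    using g_mono o le that unfolding grad_mono_orth_def by blast
  have "f x - e \<le> growth n D \<xi> (g x) x0 x" using ch D \<xi> by (simp add: charged_def)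
  moreover have "growth n D \<xi> (g x) x0 x + growth n D \<xi> (g y) x y \<le> growth n D \<xi> (g y) x0 y"
    using \<xi>o o g_orth[OF o(2)] gle le by (intro growth_mono) (auto simp: orth_nonneg)
  moreover have "0 \<le> growth n D \<xi> (g y) x y"
    unfolding growth_def
    using \<xi>o o g_orth[OF o(3)] le pot_mono
    by (intro sum_nonneg mult_nonneg_nonneg) (auto simp: orth_nonneg vle_def)
  ultimately show "f y - (e + (f y - f x)) \<le> growth n D \<xi> (g y) x0 y" by linarith
qed

end

section \<open>Buying the advice\<close>

abbreviation (input) vmax :: "vec \<Rightarrow> vec \<Rightarrow> vec" where
  "vmax x y \<equiv> \<lambda>i. max (x i) (y i)"

lemma vle_vmax: "vle x (vmax x y)" "vle y (vmax x y)"
  by (auto simp: vle_def)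

lemma zero_orth: "(\<lambda>_. 0) \<in> orth n"
  by (simp add: orth_def)

lemma zero_vle: "x \<in> orth n \<Longrightarrow> vle (\<lambda>_. 0) x"
  by (simp add: vle_def orth_nonneg)

locale advised_cost = growth_cost +
  fixes x' :: vec
  assumes advice: "x' \<in> orth n"
begin

definition bought :: "real \<Rightarrow> real \<Rightarrow> vec list \<Rightarrow> vec \<Rightarrow> bool" where
  "bought E K rs x \<longleftrightarrow> feasible n rs x \<and> vle x' x \<and>
     (\<exists>e\<le>E. charged n f g rs (\<lambda>_. 0) e x) \<and> (feasible n rs x' \<longrightarrow> f x \<le> K)"

lemma bought_step:
  assumes b: "bought E K rs x" and rs: "\<forall>a\<in>set rs. valid_row n a" and r: "valid_row n r"
  shows "\<exists>z. bought E K (rs @ [r]) z \<and> vle x z"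
proof -
  have fx: "feasible n rs x" and xo: "x \<in> orth n" and x'x: "vle x' x"
    using b by (auto simp: bought_def feasible_def)
  obtain e where e: "e \<le> E" "charged n f g rs (\<lambda>_. 0) e x" using b by (auto simp: bought_def)
  obtain z where z: "covering_move n f g r x z"
    using monotone_cost.covering_move_exists[OF plain_cost xo r] by blast
  have "charged n f g (rs @ [r]) (\<lambda>_. 0) e z"
    by (rule monotone_cost.charged_snoc[OF plain_cost e(2) zero_orth xo zero_vle[OF xo] z])
  moreover have "f z \<le> K" if "feasible n (rs @ [r]) x'"
  proof -
    have "dotn n r x' \<le> dotn n r x" using dotn_mono[OF _ x'x] r by (simp add: valid_row_def)
    then have "1 \<le> dotn n r x" using that by (simp add: feasible_snoc)
    then have "z = x" using z by (simp add: covering_move_def)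
    then show ?thesis using b that by (simp add: bought_def feasible_snoc)
  qed
  moreover have "vle x z" using z by (simp add: covering_move_def)
  ultimately show ?thesis
    using covering_move_feasible[OF z fx vle_refl rs] e(1) vle_trans[OF x'x]
    unfolding bought_def by blast
qed

text \<open>The purchase precedes serving the row r that triggers it, so its charge refers to rs
  only; r is then served by an ordinary move from the maximum.\<close>

lemma buy:
  assumes fx: "feasible n rs x" and rs: "\<forall>a\<in>set rs. valid_row n a" and r: "valid_row n r"
    and e: "charged n f g rs (\<lambda>_. 0) e (vmax x x')" "e \<le> E" and K: "f (vmax x x') \<le> K"
  shows "\<exists>z. bought E K (rs @ [r]) z \<and> vle x z"
proof -
  have "vmax x x' \<in> orth n" using orth_max fx advice by (simp add: feasible_def)
  then have "feasible n rs (vmax x x')" using feasible_mono[OF fx rs] vle_vmax by blast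
  then have "bought E K rs (vmax x x')"
    using e K vle_vmax by (auto simp: bought_def)
  from bought_step[OF this rs r] show ?thesis using vle_trans[OF vle_vmax(1)] by blast
qed

lemma f_vmax_le: "x \<in> orth n \<Longrightarrow> f (vmax x x') \<le> f (vadd x x')"
  using advice by (intro f_mono orth_max orth_add) (auto simp: vle_def orth_nonneg)

lemma bought_budget:
  assumes "bought E K rs x" "\<forall>a\<in>set rs. valid_row n a" "7/2 \<le> c"
  shows "f x - E \<le> 7 / (2 * c * p) * (budget c rs + (p - 1) * f x)"
proof -
  obtain e where e: "e \<le> E" "charged n f g rs (\<lambda>_. 0) e x" using assms by (auto simp: bought_def)
  have "x \<in> orth n" using assms by (simp add: bought_def feasible_def)
  from charged_budget[OF assms(2) e(2) zero_orth this assms(3)] e(1) show ?thesis by linarith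
qed

text \<open>For bounded \<open>p\<close> the advice is bought once the budget exceeds a large multiple \<open>M\<close> of its cost.
  Then \<open>f (x + x')\<close> exceeds \<open>f x\<close> by only a small fraction of the budget.\<close>

lemma small_growth_online:
  assumes t: "0 < t" "t < 1" and t1: "(1 - t) powr (1 - p) \<le> 17/16" and t2: "16 * t powr (1 - p) \<le> M"
  shows "\<exists>A. \<forall>rs. (\<forall>a\<in>set rs. valid_row n a) \<longrightarrow>
     feasible n rs (A rs) \<and> f (A rs) \<le> budget 4 rs \<and> (feasible n rs x' \<longrightarrow> f (A rs) \<le> 2 * M * f x') \<and>
     (\<forall>r. valid_row n r \<longrightarrow> vle (A rs) (A (rs @ [r])))"
proof -
  define V where "V = f x'"
  have V: "0 \<le> V" using nonneg[OF advice] by (simp add: V_def)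
  have "0 < t powr (1 - p)" using t by simp
  then have M: "0 \<le> M" using t2 by linarith
  have MV: "0 \<le> M * V" using M V by simp
  \<comment> \<open>With c = 4 the coefficient is 7 / (8 p), so (p + 7) / 8 of y stays on the left;
    an uncharged part of B / 8 brings the right side to exactly (p + 7) / 8 times B.\<close>
  have key: "y \<le> B" if "y - e \<le> 7 / (2 * 4 * p) * (B + (p - 1) * y)" "e \<le> B / 8" for y e B
  proof -
    have "p * (y - e) \<le> 7/8 * (B + (p - 1) * y)" using that(1) p1 by (simp add: field_simps)
    moreover have "p * e \<le> p * (B / 8)" using that(2) p1 by (intro mult_left_mono) auto
    ultimately have "(p + 7) * y \<le> (p + 7) * B" by (simp add: algebra_simps)
    then show ?thesis using p1 by simp
  qed
  define wait where "wait rs x \<longleftrightarrow> feasible n rs x \<and> budget 4 rs \<le> M * V \<and>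
    charged n f g rs (\<lambda>_. 0) 0 x" for rs x
  define Inv where "Inv rs x \<longleftrightarrow> wait rs x \<or>
    M * V < budget 4 rs \<and> bought (M * V / 8) (2 * M * V) rs x" for rs x
  have wait_le: "f x \<le> budget 4 rs" if "wait rs x" "\<forall>a\<in>set rs. valid_row n a" for rs x
  proof -
    have "f x - 0 \<le> 7 / (2 * 4 * p) * (budget 4 rs + (p - 1) * f x)"
      by (rule charged_budget) (use that zero_orth in \<open>auto simp: wait_def feasible_def\<close>)
    then show ?thesis by (rule key) (use budget_nonneg[OF that(2)] in simp)
  qed
  have start: "Inv [] (\<lambda>_. 0)"
    using MV charged_refl[of n f g "[]" "\<lambda>_. 0"] zero_orth[of n] at_0
    by (simp add: Inv_def wait_def feasible_def budget_Nil)
  have step: "\<exists>z. Inv (rs @ [r]) z \<and> vle x z"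
    if rs: "\<forall>a\<in>set rs. valid_row n a" and I: "Inv rs x" and r: "valid_row n r" for rs r x
  proof -
    have mono: "budget 4 rs \<le> budget 4 (rs @ [r])" by (rule budget_mono[OF rs r]) simp
    consider (w) "wait rs x" | (b) "M * V < budget 4 rs" "bought (M * V / 8) (2 * M * V) rs x"
      using I by (auto simp: Inv_def)
    then show ?thesis
    proof cases
      case w
      have fx: "feasible n rs x" and xo: "x \<in> orth n" and ch: "charged n f g rs (\<lambda>_. 0) 0 x"
        using w by (auto simp: wait_def feasible_def)
      show ?thesis
      proof (cases "budget 4 (rs @ [r]) \<le> M * V")
        case True
        obtain z where z: "covering_move n f g r x z"
          using monotone_cost.covering_move_exists[OF plain_cost xo r] by blast
        have "wait (rs @ [r]) z"
          unfolding wait_def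
          using covering_move_feasible[OF z fx vle_refl rs] True
            monotone_cost.charged_snoc[OF plain_cost ch zero_orth xo zero_vle[OF xo] z] by blast
        then show ?thesis using z by (auto simp: Inv_def covering_move_def)
      next
        case False
        let ?y = "vmax x x'"
        have yo: "?y \<in> orth n" using orth_max[OF xo advice] .
        have fxM: "f x \<le> M * V" using wait_le[OF w rs] w by (simp add: wait_def)
        have "f ?y \<le> (1 - t) powr (1 - p) * f x + t powr (1 - p) * V"
          using f_vmax_le[OF xo] f_add_le[OF xo advice t] by (simp add: V_def)
        also have "\<dots> \<le> 17/16 * f x + M / 16 * V"
          using t1 t2 nonneg[OF xo] V by (intro add_mono mult_right_mono) auto
        finally have fy: "f ?y \<le> 17/16 * f x + M / 16 * V" .
        \<comment> \<open>Waiting guarantees f x <= M V, so the overhead f x / 16 + M V / 16 is at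
          most M V / 8.\<close>
        have "0 + (f ?y - f x) \<le> M * V / 8" "f ?y \<le> 2 * M * V" using fy fxM MV by simp_all
        from buy[OF fx rs r charged_jump[OF ch zero_orth xo yo zero_vle[OF xo] vle_vmax(1)] this]
        show ?thesis using False by (auto simp: Inv_def)
      qed
    next
      case b
      then show ?thesis using bought_step[OF b(2) rs r] mono by (force simp: Inv_def)
    qed
  qed
  obtain A where A: "\<And>rs. \<forall>a\<in>set rs. valid_row n a \<Longrightarrow>
      Inv rs (A rs) \<and> (\<forall>r. valid_row n r \<longrightarrow> vle (A rs) (A (rs @ [r])))"
    using online_from_invariant[of Inv "\<lambda>_. 0" "valid_row n", OF start step] by blast
  have "feasible n rs x \<and> f x \<le> budget 4 rs \<and> (feasible n rs x' \<longrightarrow> f x \<le> 2 * M * f x')"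
    if I: "Inv rs x" and rs: "\<forall>a\<in>set rs. valid_row n a" for rs x
  proof -
    consider (w) "wait rs x" | (b) "M * V < budget 4 rs" "bought (M * V / 8) (2 * M * V) rs x"
      using I by (auto simp: Inv_def)
    then show ?thesis
    proof cases
      case w
      then have "f x \<le> M * V" using wait_le[OF w rs] by (simp add: wait_def)
      then have "f x \<le> 2 * M * f x'" using MV by (simp add: V_def)
      then show ?thesis using wait_le[OF w rs] w by (simp add: wait_def)
    next
      case b
      have "f x \<le> budget 4 rs"
        by (rule key[OF bought_budget[OF b(2) rs]]) (use b(1) in auto)
      then show ?thesis using b(2) by (simp add: bought_def V_def)
    qed
  qed
  then show ?thesis using A by blast
qed

end

section \<open>Buying after phases, for large p\<close>

context advised_cost
begin

text \<open>The weight is matched to \<open>young_charge\<close> with parameter m at the shifted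
  point: m^(p-1) * m * m^(-p) = 1, so both summands charge the same budget, while the shifted one
  sees its own value with an extra factor m. That factor is what keeps its relative growth of order
  m.\<close>

definition phase_cost :: "real \<Rightarrow> vec \<Rightarrow> real" where
  "phase_cost m x = f x + m powr (p - 1) * f (vadd x' x)"

definition phase_grad :: "real \<Rightarrow> vec \<Rightarrow> vec" where
  "phase_grad m x = (\<lambda>i. g x i + m powr (p - 1) * g (vadd x' x) i)"

lemma phase_monotone_cost: "monotone_cost n (phase_cost m) (phase_grad m)"
  using shifted_cost[OF advice, of "m powr (p - 1)"]
  unfolding phase_cost_def[abs_def] phase_grad_def[abs_def] by simp

text \<open>In a phase with parameter \<open>m\<close> the budget is within a factor \<open>(26/25)\<^sup>p\<close> of \<open>m\<^sup>p f x'\<close>, and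
  the moves are made with respect to \<open>f x + m\<^sup>p\<^sup>-\<^sup>1 f (x' + x)\<close>; this keeps \<open>f x\<close> proportional to the budget
  and lets \<open>f (x' + x)\<close> grow only by a factor \<open>exp (28 m)\<close>. The \<open>m\<close> of successive
  phases increase geometrically, so that \<open>f (x' + x)\<close> stays proportional to \<open>f x'\<close>.\<close>

definition phase :: "vec list \<Rightarrow> vec \<Rightarrow> real \<Rightarrow> bool" where
  "phase rs x m \<longleftrightarrow> 0 \<le> m \<and> m \<le> 1 \<and> budget (91/25) rs \<le> m powr p * f x' \<and>
     m powr p * f x' \<le> (26/25) powr p * budget (91/25) rs \<and>
     (\<exists>x0\<in>orth n. vle x0 x \<and> f x0 \<le> m powr p * f x' \<and> f (vadd x' x0) \<le> f x' * exp (700 * m) \<and>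
        charged n (phase_cost m) (phase_grad m) rs x0 (phase_cost m x0) x)"

lemma phase_charge:
  assumes rs: "\<forall>a\<in>set rs. valid_row n a" and m: "0 < m" "m \<le> 1"
    and x: "x0 \<in> orth n" "x \<in> orth n"
    and ch: "charged n (phase_cost m) (phase_grad m) rs x0 (phase_cost m x0) x"
  shows "phase_cost m x - phase_cost m x0 \<le> 25 / (26 * p) *
    (2 * budget (91/25) rs + (p - 1) * f x + m powr (p - 1) * m * (p - 1) * f (vadd x' x))"
proof -
  define L where "L = log_sparsity n rs"
  define k where "k = 25 / (26 * p)"
  define \<theta> where "\<theta> = m powr (p - 1)"
  define b where "b = (91/25 * p * L) powr p"
  let ?w = "vadd x' x"
  have w: "?w \<in> orth n" using orth_add[OF advice x(2)] .
  have k: "0 \<le> k" using p1 by (simp add: k_def)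
  have c: "7 / (2 * (91/25) * p) = k" by (simp add: k_def)
  have \<theta>: "0 \<le> \<theta>" by (simp add: \<theta>_def)
  have "\<theta> * (m * m powr (-p)) = m powr (p - 1) * m powr 1 * m powr (-p)"
    using m by (simp add: \<theta>_def)
  also have "\<dots> = 1" using m by (simp only: powr_add[symmetric]) simp
  finally have one: "\<theta> * (m * m powr (-p)) = 1" .
  have "phase_cost m x - phase_cost m x0
      \<le> (k * (p - 1) * f x + k * \<theta> * m * (p - 1) * f ?w) + (2 * k * b) * f \<xi>" if \<xi>: "feasible n rs \<xi>" for \<xi>
  proof -
    have "phase_cost m x - phase_cost m x0 \<le> 7/2 * L * dotn n \<xi> (phase_grad m x)"
      unfolding L_def
      by (rule charged_le[OF ch x _ \<xi>]) (rule monotone_cost.G_nonneg[OF phase_monotone_cost x(2)])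
    also have "dotn n \<xi> (phase_grad m x) = dotn n \<xi> (g x) + \<theta> * dotn n \<xi> (g ?w)"
      unfolding dotn_def phase_grad_def \<theta>_def
      by (simp add: distrib_left sum.distrib sum_distrib_left mult.left_commute)
    also have "7/2 * L * (dotn n \<xi> (g x) + \<theta> * dotn n \<xi> (g ?w))
        = 7/2 * L * dotn n \<xi> (g x) + \<theta> * (7/2 * L * dotn n \<xi> (g ?w))"
      by (simp add: algebra_simps)
    also have "\<dots> \<le> k * 1 * (1 powr (-p) * b * f \<xi> + (p - 1) * f x)
        + \<theta> * (k * m * (m powr (-p) * b * f \<xi> + (p - 1) * f ?w))"
      using young_charge[OF \<xi> x(2), of "91/25" 1] young_charge[OF \<xi> w, of "91/25" m] m \<theta>
      unfolding c L_def b_def by (intro add_mono mult_left_mono) auto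
    also have "\<dots> = (k * (p - 1) * f x + k * \<theta> * m * (p - 1) * f ?w)
        + (k + k * (\<theta> * (m * m powr (-p)))) * b * f \<xi>"
      by (simp add: algebra_simps)
    finally show ?thesis unfolding one by (simp add: algebra_simps)
  qed
  then have "phase_cost m x - phase_cost m x0
      \<le> (k * (p - 1) * f x + k * \<theta> * m * (p - 1) * f ?w) + (2 * k * b) * OPT n f rs"
    using k by (intro le_affine_OPT[OF rs]) (auto simp: b_def)
  also have "\<dots> = k * (2 * (b * OPT n f rs) + (p - 1) * f x + \<theta> * m * (p - 1) * f ?w)"
    by (simp add: algebra_simps)
  finally show ?thesis by (simp add: k_def \<theta>_def b_def L_def budget_def)
qed

text \<open>Here A = f x, H = f (x' + x), A0 and H0 are their values at the start of the phase, V =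
  f x', W = m^p V. Moving (25/26) A to the left and dividing by theta gives H (1 - 25 m / 26) <= H0
  + 3 m V <= H0 exp (3 m).\<close>

lemma phase_arith:
  fixes A A0 H H0 V W \<theta> m E q :: real
  assumes le: "A + \<theta> * H - (A0 + \<theta> * H0) \<le> 25 / (26 * q) * (2 * W + (q - 1) * A + \<theta> * m * (q - 1) * H)"
    and q: "1 \<le> q" and m: "0 < m" "m \<le> 1" and \<theta>: "0 < \<theta>" and W: "W = \<theta> * m * V" and V: "0 \<le> V" "V \<le> H0"
    and A: "0 \<le> A" "A0 \<le> W" and H: "H0 \<le> H" "H0 \<le> V * exp (700 * m)"
  shows "H \<le> V * exp (728 * m)" "A \<le> 26 * (exp 728 + 3) * W"
proof -
  have H_nn: "0 \<le> H" using V H by linarith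
  have W_nn: "0 \<le> W" using W m \<theta> V by simp
  define k where "k = 25 / (26 * q)"
  have q26: "k * (q - 1) \<le> 25/26" "k * 2 \<le> 2" "0 \<le> k"
    using q by (auto simp: k_def field_simps)
  have "k * (2 * W + (q - 1) * A + \<theta> * m * (q - 1) * H)
      = (k * 2) * W + (k * (q - 1)) * A + (k * (q - 1)) * (\<theta> * m * H)"
    by (simp add: algebra_simps)
  also have "\<dots> \<le> 2 * W + 25/26 * A + 25/26 * (\<theta> * m * H)"
    using q26 W_nn A H_nn m \<theta> by (intro add_mono mult_right_mono) auto
  finally have main: "A / 26 + \<theta> * H \<le> \<theta> * H0 + 3 * W + 25/26 * (\<theta> * m * H)"
    using le A unfolding k_def[symmetric] by linarith
  have mV: "m * V \<le> m * H0" using m V by (intro mult_left_mono) auto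
  have "\<theta> * (H * (1 - 25/26 * m)) \<le> \<theta> * (H0 + 3 * (m * V))"
    using main A W by (simp add: algebra_simps)
  then have "H * (1 - 25/26 * m) \<le> H0 + 3 * (m * V)" using \<theta> by simp
  also have "\<dots> \<le> H0 * (1 + 3 * m)" using mV by (simp add: algebra_simps)
  also have "\<dots> \<le> H0 * exp (3 * m)"
    using exp_ge_add_one_self[of "3 * m"] V by (intro mult_left_mono) auto
  finally have H1: "H * (1 - 25/26 * m) \<le> H0 * exp (3 * m)" .
  have "m * m \<le> m * 1" using m by (intro mult_left_mono) auto
  \<comment> \<open>The product equals 1 + (625/26) m (1 - m). Thus the growth exponent of a phase
    is 3 m + 25 m = 28 m.\<close>
  then have "1 \<le> (1 - 25/26 * m) * (1 + 25 * m)" by (simp add: algebra_simps)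
  also have "\<dots> \<le> (1 - 25/26 * m) * exp (25 * m)"
    using exp_ge_add_one_self[of "25 * m"] m by (intro mult_left_mono) auto
  finally have "H * 1 \<le> H * ((1 - 25/26 * m) * exp (25 * m))" using H_nn by (intro mult_left_mono) auto
  also have "\<dots> = H * (1 - 25/26 * m) * exp (25 * m)" by simp
  also have "\<dots> \<le> H0 * exp (3 * m) * exp (25 * m)" using H1 by (intro mult_right_mono) auto
  also have "\<dots> \<le> V * exp (700 * m) * exp (3 * m) * exp (25 * m)"
    using H by (intro mult_right_mono) auto
  also have "\<dots> = V * exp (728 * m)" by (simp add: mult.assoc exp_add[symmetric])
  finally show H2: "H \<le> V * exp (728 * m)" by simp
  also have "\<dots> \<le> V * exp 728" using m V by (intro mult_left_mono) auto
  finally have "\<theta> * m * H \<le> \<theta> * m * (V * exp 728)" using \<theta> m by (intro mult_left_mono) auto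
  also have "\<dots> = exp 728 * W" using W by simp
  finally have "\<theta> * m * H \<le> exp 728 * W" .
  moreover have "\<theta> * H0 \<le> \<theta> * H" using \<theta> H by simp
  moreover have "0 \<le> \<theta> * m * H" using \<theta> m H_nn by simp
  ultimately have "A / 26 \<le> 3 * W + exp 728 * W" using main by linarith
  then show "A \<le> 26 * (exp 728 + 3) * W" by (simp add: algebra_simps)
qed

lemma phase_bounds:
  assumes ph: "phase rs x m" and rs: "\<forall>a\<in>set rs. valid_row n a" and x: "x \<in> orth n"
  shows "f (vadd x' x) \<le> f x' * exp (728 * m)" "f x \<le> 26 * (exp 728 + 3) * (m powr p * f x')"
proof -
  obtain x0 where m: "0 \<le> m" "m \<le> 1" and B: "budget (91/25) rs \<le> m powr p * f x'"
    and x0: "x0 \<in> orth n" "vle x0 x" "f x0 \<le> m powr p * f x'" "f (vadd x' x0) \<le> f x' * exp (700 * m)"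
    and ch: "charged n (phase_cost m) (phase_grad m) rs x0 (phase_cost m x0) x"
    using ph by (auto simp: phase_def)
  have "f (vadd x' x) \<le> f x' * exp (728 * m) \<and> f x \<le> 26 * (exp 728 + 3) * (m powr p * f x')"
  proof (cases "m = 0")
    \<comment> \<open>For m = 0 the weight \<open>0 powr (p - 1)\<close> is 0, also for p = 1, so
      the phase cost is f. The budget is 0, which forces f x = 0, and adding such an x to x' does
      not change the cost.\<close>
    case True
    have "phase_cost m = f" "phase_grad m = g"
      by (auto simp: phase_cost_def phase_grad_def True)
    then have ch': "charged n f g rs x0 (f x0) x" using ch by simp
    have "f x - f x0 \<le> 7 / (2 * (91/25) * p) * (budget (91/25) rs + (p - 1) * f x)"
      by (rule charged_budget[OF rs ch' x0(1) x]) simp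
    also have "\<dots> \<le> 7 / (2 * (91/25) * p) * ((p - 1) * f x)"
      using B True p1 by (intro mult_left_mono) auto
    finally have "p * (f x - f x0) \<le> 25/26 * ((p - 1) * f x)"
      using p1 by (simp add: field_simps)
    moreover have "p * f x0 \<le> 0" using x0(3) True p1 by (simp add: mult_nonneg_nonpos)
    ultimately have "(p + 25) * f x \<le> 0" by (simp add: algebra_simps)
    then have "f x = 0" using p1 nonneg[OF x] by (simp add: mult_le_0_iff)
    then show ?thesis using f_add_null[OF advice x] True by simp
  next
    case False
    then have m0: "0 < m" using m by simp
    have W: "m powr p * f x' = m powr (p - 1) * m * f x'" using m0 by (simp add: powr_diff)
    have wo: "vadd x' x0 \<in> orth n" "vadd x' x \<in> orth n" using orth_add[OF advice] x0 x by auto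
    have "phase_cost m x - phase_cost m x0 \<le> 25 / (26 * p) *
        (2 * budget (91/25) rs + (p - 1) * f x + m powr (p - 1) * m * (p - 1) * f (vadd x' x))"
      by (rule phase_charge[OF rs m0 m(2) x0(1) x ch])
    also have "\<dots> \<le> 25 / (26 * p) *
        (2 * (m powr p * f x') + (p - 1) * f x + m powr (p - 1) * m * (p - 1) * f (vadd x' x))"
      using B p1 by (intro mult_left_mono add_right_mono) auto
    finally have le: "f x + m powr (p - 1) * f (vadd x' x) - (f x0 + m powr (p - 1) * f (vadd x' x0))
        \<le> 25 / (26 * p) *
        (2 * (m powr p * f x') + (p - 1) * f x + m powr (p - 1) * m * (p - 1) * f (vadd x' x))"
      by (simp add: phase_cost_def)
    have "f x' \<le> f (vadd x' x0)"
      by (rule f_mono[OF advice wo(1)]) (use x0(1) in \<open>simp add: vle_def orth_nonneg\<close>)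
    moreover have "f (vadd x' x0) \<le> f (vadd x' x)"
      by (rule f_mono[OF wo]) (use x0(2) in \<open>simp add: vle_def\<close>)
    ultimately show ?thesis
      using phase_arith[OF le p1 m0 m(2) _ W nonneg[OF advice] _ nonneg[OF x] x0(3) _ x0(4)] m0 by simp
  qed
  then show "f (vadd x' x) \<le> f x' * exp (728 * m)" "f x \<le> 26 * (exp 728 + 3) * (m powr p * f x')"
    by auto
qed

lemma phase_move:
  assumes ph: "phase rs x m" and rs: "\<forall>a\<in>set rs. valid_row n a" and r: "valid_row n r"
    and fx: "feasible n rs x" and B: "budget (91/25) (rs @ [r]) \<le> m powr p * f x'"
  shows "\<exists>z. feasible n (rs @ [r]) z \<and> phase (rs @ [r]) z m \<and> vle x z"
proof -
  have xo: "x \<in> orth n" using fx by (simp add: feasible_def)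
  obtain x0 where m: "0 \<le> m" "m \<le> 1" and B': "m powr p * f x' \<le> (26/25) powr p * budget (91/25) rs"
    and x0: "x0 \<in> orth n" "vle x0 x" "f x0 \<le> m powr p * f x'" "f (vadd x' x0) \<le> f x' * exp (700 * m)"
    and ch: "charged n (phase_cost m) (phase_grad m) rs x0 (phase_cost m x0) x"
    using ph by (auto simp: phase_def)
  obtain z where z: "covering_move n (phase_cost m) (phase_grad m) r x z"
    using monotone_cost.covering_move_exists[OF phase_monotone_cost xo r] by blast
  have xz: "vle x z" using z by (simp add: covering_move_def)
  have "(26/25) powr p * budget (91/25) rs \<le> (26/25) powr p * budget (91/25) (rs @ [r])"
    using budget_mono[OF rs r] by (intro mult_left_mono) auto
  then have "m powr p * f x' \<le> (26/25) powr p * budget (91/25) (rs @ [r])" using B' by linarith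
  moreover have "charged n (phase_cost m) (phase_grad m) (rs @ [r]) x0 (phase_cost m x0) z"
    by (rule monotone_cost.charged_snoc[OF phase_monotone_cost ch x0(1) xo x0(2) z])
  ultimately have "phase (rs @ [r]) z m"
    unfolding phase_def using m B x0 vle_trans[OF x0(2) xz] by blast
  then show ?thesis using covering_move_feasible[OF z fx vle_refl rs] xz by blast
qed

text \<open>The new scale satisfies m' >= (26/25) m. Summing exponents 28 m over such a sequence
  gives at most 26 * 28 = 728 times the last m, and 728 * 25/26 = 700 is what the next phase starts
  with. The overshoot (26/25)^p also absorbs the constant of \<open>phase_bounds\<close>, so that f
  x <= m'^p f x' at the start.\<close>

lemma new_phase:
  assumes ph: "phase rs x m" and rs: "\<forall>a\<in>set rs. valid_row n a" and xo: "x \<in> orth n"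
    and big: "26 * (exp 728 + 3) \<le> (26/25) powr p"
    and B: "m powr p * f x' < B" "(26/25) powr p * B \<le> f x'"
  shows "\<exists>m'. 0 \<le> m' \<and> m' \<le> 1 \<and> m' powr p * f x' = (26/25) powr p * B \<and>
     f x \<le> m' powr p * f x' \<and> f (vadd x' x) \<le> f x' * exp (700 * m')"
proof -
  have p0: "0 < p" using p1 by simp
  have m: "0 \<le> m" using ph by (simp add: phase_def)
  have V: "0 \<le> f x'" using nonneg[OF advice] .
  then have B0: "0 < B" using B(1) m by (meson le_less_trans mult_nonneg_nonneg powr_ge_zero)
  then have "0 < (26/25) powr p * B" by simp
  then have V0: "0 < f x'" using B(2) by linarith
  define m' where "m' = 26/25 * (B / f x') powr (1 / p)"
  have m'0: "0 < m'" using B0 V0 by (simp add: m'_def)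
  have m'p: "m' powr p = (26/25) powr p * (B / f x')"
    using B0 V0 p0 unfolding m'_def by (subst powr_mult) (auto simp: powr_powr)
  then have eq: "m' powr p * f x' = (26/25) powr p * B" using V0 by simp
  have "m' powr p \<le> 1 powr p" using m'p B(2) V0 by (simp add: divide_le_eq)
  then have m'1: "m' \<le> 1" using powr_less_mono2[OF p0, of 1 m'] by force
  have "m powr p < B / f x'" using B(1) V0 by (simp add: less_divide_eq)
  also have "\<dots> = ((B / f x') powr (1 / p)) powr p" using B0 V0 p0 by (simp add: powr_powr)
  finally have "m < (B / f x') powr (1 / p)"
    using powr_mono2[of p "(B / f x') powr (1 / p)" m] p0 by force
  then have "728 * m \<le> 700 * m'" by (simp add: m'_def)
  then have "f x' * exp (728 * m) \<le> f x' * exp (700 * m')" using V by (intro mult_left_mono) auto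
  then have "f (vadd x' x) \<le> f x' * exp (700 * m')" using phase_bounds(1)[OF ph rs xo] by linarith
  moreover have "f x \<le> m' powr p * f x'"
  proof -
    have "f x \<le> 26 * (exp 728 + 3) * (m powr p * f x')" by (rule phase_bounds(2)[OF ph rs xo])
    also have "\<dots> \<le> (26/25) powr p * B"
      using big B(1) V B0 by (intro mult_mono) auto
    finally show ?thesis using eq by simp
  qed
  ultimately show ?thesis using eq m'0 m'1 by (intro exI[of _ m']) auto
qed

text \<open>Waiting ends when R B exceeds f x', that is, when the next phase would need m' > 1. At
  that moment f (x' + x), and with it the cost after buying, is still at most exp 728 * f
  x'.\<close>

lemma large_growth_online:
  assumes big: "26 * (exp 728 + 3) \<le> (26/25) powr p"
  shows "\<exists>A. \<forall>rs. (\<forall>a\<in>set rs. valid_row n a) \<longrightarrow>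
     feasible n rs (A rs) \<and> f (A rs) \<le> budget 4 rs \<and> (feasible n rs x' \<longrightarrow> f (A rs) \<le> exp 728 * f x') \<and>
     (\<forall>r. valid_row n r \<longrightarrow> vle (A rs) (A (rs @ [r])))"
proof -
  define V where "V = f x'"
  define R where "R = (26/25::real) powr p"
  define B where "B = budget (91/25)"
  have V: "0 \<le> V" using nonneg[OF advice] by (simp add: V_def)
  have R: "0 < R" by (simp add: R_def)
  define wait where "wait rs x \<longleftrightarrow> feasible n rs x \<and> R * B rs \<le> V \<and> (\<exists>m. phase rs x m)" for rs x
  define Inv where "Inv rs x \<longleftrightarrow> wait rs x \<or>
    V < R * B rs \<and> bought (exp 728 * V) (exp 728 * V) rs x" for rs x
  have "phase [] (\<lambda>_. 0) 0"
    using zero_orth[of n] vle_refl charged_refl[of n "phase_cost 0" "phase_grad 0"] at_0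
    by (auto simp: phase_def budget_Nil intro!: bexI[of _ "\<lambda>_. 0"])
  then have start: "Inv [] (\<lambda>_. 0)"
    using zero_orth[of n] V by (auto simp: Inv_def wait_def feasible_def B_def budget_Nil)
  have wait_le: "f (vadd x' x) \<le> exp 728 * V" "f x \<le> exp 728 * V"
    if w: "wait rs x" and rs: "\<forall>a\<in>set rs. valid_row n a" for rs x
  proof -
    obtain m where ph: "phase rs x m" and xo: "x \<in> orth n" using w by (auto simp: wait_def feasible_def)
    have "f (vadd x' x) \<le> V * exp (728 * m)" using phase_bounds(1)[OF ph rs xo] by (simp add: V_def)
    also have "\<dots> \<le> V * exp 728" using V ph by (intro mult_left_mono) (auto simp: phase_def)
    finally show 1: "f (vadd x' x) \<le> exp 728 * V" by (simp add: mult.commute)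
    have "f x \<le> f (vadd x' x)"
      by (rule f_mono[OF xo orth_add[OF advice xo]]) (use advice in \<open>simp add: vle_def orth_nonneg\<close>)
    then show "f x \<le> exp 728 * V" using 1 by linarith
  qed
  have step: "\<exists>z. Inv (rs @ [r]) z \<and> vle x z"
    if rs: "\<forall>a\<in>set rs. valid_row n a" and I: "Inv rs x" and r: "valid_row n r" for rs r x
  proof -
    have "B rs \<le> B (rs @ [r])" unfolding B_def by (rule budget_mono[OF rs r]) simp
    then have mono: "R * B rs \<le> R * B (rs @ [r])" using R by simp
    consider (w) "wait rs x" | (b) "V < R * B rs" "bought (exp 728 * V) (exp 728 * V) rs x"
      using I by (auto simp: Inv_def)
    then show ?thesis
    proof cases
      case w
      have fx: "feasible n rs x" and xo: "x \<in> orth n" using w by (auto simp: wait_def feasible_def)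
      obtain m where ph: "phase rs x m" using w by (auto simp: wait_def)
      show ?thesis
      proof (cases "R * B (rs @ [r]) \<le> V")
        case True
        have "\<exists>z m. feasible n (rs @ [r]) z \<and> phase (rs @ [r]) z m \<and> vle x z"
        proof (cases "B (rs @ [r]) \<le> m powr p * V")
          case True
          then show ?thesis using phase_move[OF ph rs r fx] by (auto simp: B_def V_def)
        next
          case False
          obtain m' where m': "0 \<le> m'" "m' \<le> 1" "m' powr p * V = R * B (rs @ [r])"
            "f x \<le> m' powr p * V" "f (vadd x' x) \<le> V * exp (700 * m')"
            using new_phase[OF ph rs xo big, of "B (rs @ [r])"] False True by (auto simp: V_def R_def)
          obtain z where z: "covering_move n (phase_cost m') (phase_grad m') r x z"
            using monotone_cost.covering_move_exists[OF phase_monotone_cost xo r] by blast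
          have xz: "vle x z" using z by (simp add: covering_move_def)
          have "1 \<le> R" using p1 by (simp add: R_def ge_one_powr_ge_zero)
          then have "1 * B (rs @ [r]) \<le> R * B (rs @ [r])"
            using budget_nonneg[of "rs @ [r]"] rs r by (intro mult_right_mono) (auto simp: B_def)
          then have "B (rs @ [r]) \<le> m' powr p * V" using m'(3) by simp
          moreover have "charged n (phase_cost m') (phase_grad m') (rs @ [r]) x (phase_cost m' x) z"
            by (rule monotone_cost.charged_snoc[OF phase_monotone_cost charged_refl xo xo vle_refl z])
          ultimately have "phase (rs @ [r]) z m'"
            unfolding phase_def using m' xo xz by (auto simp: V_def B_def R_def)
          then show ?thesis using covering_move_feasible[OF z fx vle_refl rs] xz by blast
        qed
        then show ?thesis using True by (auto simp: Inv_def wait_def)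
      next
        case False
        let ?y = "vmax x x'"
        have yo: "?y \<in> orth n" using orth_max[OF xo advice] .
        \<comment> \<open>The phases charged other costs, so their charges are abandoned: the whole
          cost after the purchase counts as a jump from 0.\<close>
        have ch: "charged n f g rs (\<lambda>_. 0) (f ?y) ?y"
          using charged_jump[OF charged_refl zero_orth zero_orth yo vle_refl zero_vle[OF yo]] at_0 by simp
        have "f ?y \<le> exp 728 * V"
          using f_vmax_le[OF xo] wait_le(1)[OF w rs] by (simp add: add.commute)
        from buy[OF fx rs r ch this this] show ?thesis using False by (auto simp: Inv_def)
      qed
    next
      case b
      then show ?thesis using bought_step[OF b(2) rs r] mono by (force simp: Inv_def)
    qed
  qed
  obtain A where A: "\<And>rs. \<forall>a\<in>set rs. valid_row n a \<Longrightarrow>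
      Inv rs (A rs) \<and> (\<forall>r. valid_row n r \<longrightarrow> vle (A rs) (A (rs @ [r])))"
    using online_from_invariant[of Inv "\<lambda>_. 0" "valid_row n", OF start step] by blast
  have "feasible n rs x \<and> f x \<le> budget 4 rs \<and> (feasible n rs x' \<longrightarrow> f x \<le> exp 728 * f x')"
    if I: "Inv rs x" and rs: "\<forall>a\<in>set rs. valid_row n a" for rs x
  proof -
    have B_nn: "0 \<le> B rs" using budget_nonneg[OF rs] by (simp add: B_def)
    have L: "0 \<le> log_sparsity n rs" using log_sparsity_ge_1[of n rs] by linarith
    have "26 * (exp 728 + 3) * (R * B rs) \<le> R * (R * B rs)"
      using big R B_nn by (intro mult_right_mono) (auto simp: R_def)
    \<comment> \<open>(26/25)^2 * (91/25) is about 3.937, below 4.\<close>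
    also have "\<dots> = (26/25 * (26/25) * (91/25 * p * log_sparsity n rs)) powr p * OPT n f rs"
      by (simp only: R_def B_def budget_def powr_mult mult.assoc)
    also have "\<dots> \<le> (4 * p * log_sparsity n rs) powr p * OPT n f rs"
      using p1 L OPT_nonneg[OF rs]
      by (intro mult_right_mono powr_mono2) (auto intro!: mult_right_mono simp flip: mult.assoc)
    finally have robust: "26 * (exp 728 + 3) * (R * B rs) \<le> budget 4 rs" by (simp add: budget_def)
    consider (w) "wait rs x" | (b) "V < R * B rs" "bought (exp 728 * V) (exp 728 * V) rs x"
      using I by (auto simp: Inv_def)
    then show ?thesis
    proof cases
      case w
      obtain m where ph: "phase rs x m" and xo: "x \<in> orth n" using w by (auto simp: wait_def feasible_def)
      have "f x \<le> 26 * (exp 728 + 3) * (m powr p * V)"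
        using phase_bounds(2)[OF ph rs xo] by (simp add: V_def)
      also have "\<dots> \<le> 26 * (exp 728 + 3) * (R * B rs)"
        using ph by (intro mult_left_mono) (auto simp: phase_def V_def R_def B_def add_nonneg_nonneg)
      finally show ?thesis using robust wait_le(2)[OF w rs] w by (simp add: wait_def V_def)
    next
      case b
      have xo: "x \<in> orth n" using b(2) by (simp add: bought_def feasible_def)
      have "f x - exp 728 * V \<le> 7 / (2 * (91/25) * p) * (B rs + (p - 1) * f x)"
        unfolding B_def by (rule bought_budget[OF b(2) rs]) simp
      then have "p * (f x - exp 728 * V) \<le> 25/26 * (B rs + (p - 1) * f x)"
        using p1 by (simp add: field_simps)
      moreover have "B rs \<le> p * B rs" "0 \<le> p * f x" "0 \<le> f x"
        using p1 B_nn nonneg[OF xo] mult_right_mono[of 1 p "B rs"] by auto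
      ultimately have "p * f x \<le> p * (26 * (exp 728 * V + B rs))" using B_nn
        by (simp add: algebra_simps)
      then have "f x \<le> 26 * (exp 728 * V + B rs)" using p1 by simp
      also have "\<dots> \<le> 26 * (exp 728 * (R * B rs) + 3 * (R * B rs))"
      proof -
        have "1 \<le> R" using p1 by (simp add: R_def ge_one_powr_ge_zero)
        then have "1 * B rs \<le> R * B rs" using B_nn by (rule mult_right_mono)
        moreover have "exp 728 * V \<le> exp 728 * (R * B rs)" using b(1) by simp
        moreover have "0 \<le> R * B rs" using B_nn R by simp
        ultimately show ?thesis by (intro mult_left_mono add_mono) auto
      qed
      also have "\<dots> = 26 * (exp 728 + 3) * (R * B rs)" by (simp add: algebra_simps)
      finally show ?thesis using robust b(2) by (simp add: bought_def V_def)
    qed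
  qed
  then show ?thesis using A by blast
qed

end

section \<open>The algorithm\<close>

text \<open>C must be fixed before p. Above the threshold P, (26/25)^p beats the constant of the
  phases; below it, t and M computed for P serve all smaller p, as 1 - p >= 1 - P.\<close>

lemma learning_augmented_covering:
  "\<exists>C>0. \<forall>n f g p x'. growth_cost n f g p \<longrightarrow> x' \<in> orth n \<longrightarrow>
     (\<exists>A. \<forall>rs. (\<forall>a\<in>set rs. valid_row n a) \<longrightarrow>
       feasible n rs (A rs) \<and> f (A rs) \<le> (4 * p * log_sparsity n rs) powr p * OPT n f rs \<and>
       (feasible n rs x' \<longrightarrow> f (A rs) \<le> C * f x') \<and>
       (\<forall>r. valid_row n r \<longrightarrow> vle (A rs) (A (rs @ [r]))))"
proof -
  define c :: real where "c = 26 * (exp 728 + 3)"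
  define P where "P = max 1 (log (26/25) c)"
  have c: "0 < c" by (simp add: c_def add_pos_pos)
  have "(26/25) powr log (26/25) c \<le> (26/25) powr P" by (intro powr_mono) (auto simp: P_def)
  then have P: "1 \<le> P" "c \<le> (26/25) powr P" using c by (auto simp: P_def)
  \<comment> \<open>Then (1 - t)^(1 - p) = (17/16)^((p - 1) / P) <= 17/16 for all p <= P.\<close>
  define t where "t = 1 - (16/17::real) powr (1 / P)"
  have "(16/17::real) powr (1 / P) < (16/17) powr 0" using P by (intro powr_less_mono') auto
  then have t: "0 < t" "t < 1" by (auto simp: t_def)
  define M where "M = 16 * t powr (1 - P)"
  define C where "C = max (2 * M) (exp 728)"
  have "\<exists>A. \<forall>rs. (\<forall>a\<in>set rs. valid_row n a) \<longrightarrow>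
       feasible n rs (A rs) \<and> f (A rs) \<le> (4 * p * log_sparsity n rs) powr p * OPT n f rs \<and>
       (feasible n rs x' \<longrightarrow> f (A rs) \<le> C * f x') \<and>
       (\<forall>r. valid_row n r \<longrightarrow> vle (A rs) (A (rs @ [r])))"
    if gc: "growth_cost n f g p" and x': "x' \<in> orth n" for n f g p x'
  proof -
    interpret growth_cost n f g p by (rule gc)
    interpret advised_cost n f g p x' by unfold_locales (rule x')
    have C: "2 * M * f x' \<le> C * f x'" "exp 728 * f x' \<le> C * f x'"
      using nonneg[OF x'] by (auto simp: C_def intro!: mult_right_mono)
    have weaken: ?thesis
      if ex: "\<exists>A. \<forall>rs. (\<forall>a\<in>set rs. valid_row n a) \<longrightarrow>
          feasible n rs (A rs) \<and> f (A rs) \<le> budget 4 rs \<and> (feasible n rs x' \<longrightarrow> f (A rs) \<le> K * f x') \<and>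
          (\<forall>r. valid_row n r \<longrightarrow> vle (A rs) (A (rs @ [r])))"
        and K: "K * f x' \<le> C * f x'" for K
    proof -
      obtain A where "\<forall>rs. (\<forall>a\<in>set rs. valid_row n a) \<longrightarrow>
          feasible n rs (A rs) \<and> f (A rs) \<le> budget 4 rs \<and> (feasible n rs x' \<longrightarrow> f (A rs) \<le> K * f x') \<and>
          (\<forall>r. valid_row n r \<longrightarrow> vle (A rs) (A (rs @ [r])))" using ex by blast
      then show ?thesis using K order_trans unfolding budget_def by (intro exI[of _ A]) blast
    qed
    show ?thesis
    proof (cases "p \<le> P")
      case True
      have "(1 - t) powr (1 - p) = (16/17) powr ((1 - p) / P)" by (simp add: t_def powr_powr)
      also have "\<dots> \<le> (16/17) powr (-1)"
        using True P p1 by (intro powr_mono') (auto simp: field_simps)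
      finally have 1: "(1 - t) powr (1 - p) \<le> 17/16" by (simp add: powr_minus)
      have 2: "16 * t powr (1 - p) \<le> M" unfolding M_def using t True by (intro mult_left_mono powr_mono') auto
      show ?thesis by (rule weaken[OF small_growth_online[OF t 1 2] C(1)])
    next
      case False
      then have "(26/25::real) powr P \<le> (26/25) powr p" by (intro powr_mono) auto
      then have "26 * (exp 728 + 3) \<le> (26/25) powr p" using P unfolding c_def by linarith
      then show ?thesis by (intro weaken[OF large_growth_online C(2)])
    qed
  qed
  moreover have "0 < C" by (simp add: C_def less_max_iff_disj)
  ultimately show ?thesis by blast
qed

section \<open>From admissible costs to the growth exponent\<close>

lemma ray_derivative:
  assumes x: "x \<in> orth n" and grad: "has_grad_orth n f w x"
  shows "((\<lambda>u. f (vscale u x)) has_real_derivative dotn n w x) (at 1)"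
proof -
  have "((\<lambda>u. f (vadd (\<lambda>_. 0) (vscale u x))) has_real_derivative dotn n w x) (at 1 within {0<..})"
    by (rule derivative_along_line) (use orth_scale[OF x] grad in auto)
  then show ?thesis by (simp add: at_within_open[OF _ open_greaterThan])
qed

text \<open><x, g x> is the derivative of f along the ray through x, hence determined by f. An
  algorithm that is given f but not g can thus be chosen for the right p.\<close>

lemma pval_unique:
  assumes "admissible_cost n f g" "admissible_cost n f g'"
  shows "pval n f g = pval n f g'"
proof -
  have eq: "dotn n x (g x) = dotn n x (g' x)" if x: "x \<in> orth n" for x
    using DERIV_unique[of "\<lambda>u. f (vscale u x)" "dotn n (g x) x" 1 "dotn n (g' x) x"]
      ray_derivative[OF x, of f "g x"] ray_derivative[OF x, of f "g' x"] assms x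
    by (simp add: admissible_cost_def dotn_commute[of n x])
  have "v \<in> pset n f g \<longleftrightarrow> v \<in> pset n f g'" for v
    unfolding pset_def mem_Collect_eq using eq by metis
  then have "pset n f g = pset n f g'" by blast
  then show ?thesis by (simp add: pval_def)
qed

lemma growth_cost_of_admissible:
  assumes adm: "admissible_cost n f g"
    and le: "\<And>x. x \<in> orth n \<Longrightarrow> 0 < f x \<Longrightarrow> dotn n x (g x) / f x \<le> p" and p: "1 \<le> p"
  shows "growth_cost n f g p"
proof
  fix x assume x: "x \<in> orth n"
  have nn: "0 \<le> f y" if "y \<in> orth n" for y using adm that by (simp add: admissible_cost_def)
  show "dotn n x (g x) \<le> p * f x"
  proof (cases "f x = 0")
    case False
    then show ?thesis using le[OF x] nn[OF x] by (simp add: divide_le_eq)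
  next
    \<comment> \<open>\<open>pset\<close> says nothing where f vanishes. There f (u x) >= 0 = f x
      makes the difference quotients for u < 1 nonpositive.\<close>
    case True
    have "has_grad_orth n f (g x) x" using adm x by (simp add: admissible_cost_def)
    then have "((\<lambda>u. f (vscale u x)) has_real_derivative dotn n (g x) x) (at 1 within {0..1})"
      by (rule has_field_derivative_at_within[OF ray_derivative[OF x, of f "g x"]])
    then have "((\<lambda>u. (f (vscale u x) - f x) / (u - 1)) \<longlongrightarrow> dotn n (g x) x) (at 1 within {0..1})"
      unfolding has_field_derivative_iff by simp
    moreover have "\<forall>\<^sub>F u in at 1 within {0..1}. (f (vscale u x) - f x) / (u - 1) \<le> 0"
      unfolding eventually_at
    proof (intro exI[of _ 1] conjI ballI impI)
      fix u :: real assume u: "u \<in> {0..1}" "u \<noteq> 1 \<and> dist u 1 < 1"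
      have "0 \<le> f (vscale u x)" using nn orth_scale[OF x] u by simp
      then show "(f (vscale u x) - f x) / (u - 1) \<le> 0" using u True by (simp add: divide_nonneg_neg)
    qed simp
    ultimately have "dotn n (g x) x \<le> 0"
      by (rule tendsto_upperbound) (simp add: trivial_limit_within islimpt_Icc)
    then show ?thesis using True by (simp add: dotn_commute)
  qed
qed (use adm p in \<open>auto simp: admissible_cost_def\<close>)

lemma ratio_le_pval:
  assumes adm: "admissible_cost n f g" and x: "x \<in> orth n" "0 < f x"
  shows "dotn n x (g x) / f x \<le> pval n f g"
proof -
  have "dotn n x (g x) / f x \<in> pset n f g" using x by (auto simp: pset_def)
  then show ?thesis using adm unfolding pval_def by (auto simp: admissible_cost_def intro: cSup_upper)
qed

lemma max_pval_growth_cost: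
  assumes adm: "admissible_cost n f g"
  shows "growth_cost n f g (max 1 (pval n f g))"
proof (rule growth_cost_of_admissible[OF adm])
  fix x assume "x \<in> orth n" "0 < f x"
  from ratio_le_pval[OF adm this] show "dotn n x (g x) / f x \<le> max 1 (pval n f g)" by simp
qed simp

text \<open>The tangent at x lies below f at 0, so f x <= <x, g x>; hence p >= 1 once f is positive
  somewhere.\<close>

lemma pval_growth_cost:
  assumes adm: "admissible_cost n f g" and ne: "pset n f g \<noteq> {}"
  shows "growth_cost n f g (pval n f g)"
proof -
  interpret growth_cost n f g "max 1 (pval n f g)" by (rule max_pval_growth_cost[OF adm])
  obtain x where x: "x \<in> orth n" "0 < f x" using ne by (auto simp: pset_def)
  have "(\<lambda>_. 0) \<in> orth n" by (simp add: orth_def)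
  from gradient_below[OF x(1) this] have "f x \<le> dotn n x (g x)"
    by (simp add: at_0 dotn_commute[of n x]) (simp add: dotn_def sum_negf)
  then have "1 \<le> dotn n x (g x) / f x" using x by simp
  then have "1 \<le> pval n f g" using ratio_le_pval[OF adm x] by linarith
  then show ?thesis using growth_cost_axioms by (simp add: max_def)
qed

theorem mainTheorem3:
  shows "\<exists>(alg :: nat \<Rightarrow> (vec \<Rightarrow> real) \<Rightarrow> vec \<Rightarrow> real \<Rightarrow> vec list \<Rightarrow> vec) (C::real).
    C > 0 \<and>
    (\<forall>n f g x' lam. admissible_cost n f g \<and> x' \<in> orth n \<and> 0 < lam \<and> lam < 1 \<longrightarrow>
      (\<forall>rs. (\<forall>a\<in>set rs. valid_row n a) \<longrightarrow>
         feasible n rs (alg n f x' lam rs) \<and>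
         (\<forall>r. valid_row n r \<longrightarrow> vle (alg n f x' lam rs) (alg n f x' lam (rs @ [r]))) \<and>
         (rs \<noteq> [] \<longrightarrow>
            (let xbar = alg n f x' lam rs; p = pval n f g; d = real (row_sparsity n rs) in
               f xbar \<le> min (C / (1 - lam) * f x' + (4 * p * ln (1 + 2 * d^2)) powr p * OPT n f rs)
                             ((4 * p * ln (1 + 2 / lam * d^2)) powr p * OPT n f rs) \<and>
               (feasible n rs x' \<longrightarrow> f xbar \<le> C / (1 - lam) * f x')))))"
proof -
  obtain C where C: "0 < C" and ex: "\<And>n f g p x'. growth_cost n f g p \<Longrightarrow> x' \<in> orth n \<Longrightarrow>
     \<exists>A. \<forall>rs. (\<forall>a\<in>set rs. valid_row n a) \<longrightarrow>
       feasible n rs (A rs) \<and> f (A rs) \<le> (4 * p * log_sparsity n rs) powr p * OPT n f rs \<and>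
       (feasible n rs x' \<longrightarrow> f (A rs) \<le> C * f x') \<and>
       (\<forall>r. valid_row n r \<longrightarrow> vle (A rs) (A (rs @ [r])))"
    using learning_augmented_covering by blast
  define good where "good n f x' p A \<longleftrightarrow> (\<forall>rs. (\<forall>a\<in>set rs. valid_row n a) \<longrightarrow>
       feasible n rs (A rs) \<and> f (A rs) \<le> (4 * p * log_sparsity n rs) powr p * OPT n f rs \<and>
       (feasible n rs x' \<longrightarrow> f (A rs) \<le> C * f x') \<and>
       (\<forall>r. valid_row n r \<longrightarrow> vle (A rs) (A (rs @ [r]))))" for n f x' p A
  have good_ex: "\<exists>A. good n f x' (pval n f g) A" if adm: "admissible_cost n f g" and x': "x' \<in> orth n" for n f g x'
  proof (cases "pset n f g = {}")
    case False
    then show ?thesis using ex[OF pval_growth_cost[OF adm False] x'] by (simp add: good_def)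
  next
    \<comment> \<open>f vanishes on the orthant and \<open>pval\<close> is 0 by convention. The
      algorithm for exponent 1 is used, and its cost 0 meets every bound.\<close>
    case True
    have nn: "0 \<le> f x" if "x \<in> orth n" for x using adm that by (simp add: admissible_cost_def)
    then have z: "f x = 0" if "x \<in> orth n" for x using True that unfolding pset_def by force
    interpret growth_cost n f g 1
      by (rule growth_cost_of_admissible[OF adm]) (use z in auto)
    obtain A where "good n f x' 1 A" using ex[OF growth_cost_axioms x'] by (auto simp: good_def)
    then have "good n f x' (pval n f g) A"
      using z x' OPT_nonneg unfolding good_def by (simp add: feasible_def)
    then show ?thesis by blast
  qed
  define alg :: "nat \<Rightarrow> (vec \<Rightarrow> real) \<Rightarrow> vec \<Rightarrow> real \<Rightarrow> vec list \<Rightarrow> vec" where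
    "alg n f x' lam = (SOME A. \<forall>g. admissible_cost n f g \<longrightarrow> good n f x' (pval n f g) A)" for n f x' lam
  have alg: "good n f x' (pval n f g) (alg n f x' lam)"
    if adm: "admissible_cost n f g" and x': "x' \<in> orth n" for n f g x' lam
  proof -
    obtain A where "good n f x' (pval n f g) A" using good_ex[OF adm x'] by blast
    then have "\<forall>g. admissible_cost n f g \<longrightarrow> good n f x' (pval n f g) A"
      using pval_unique[OF adm] by metis
    from someI[where P = "\<lambda>A. \<forall>g. admissible_cost n f g \<longrightarrow> good n f x' (pval n f g) A", OF this]
    show ?thesis using adm unfolding alg_def by blast
  qed
  \<comment> \<open>Both entries of the minimum dominate the robust bound: the first adds a
    nonnegative term, and the second has 2 / lam >= 2 inside the logarithm.\<close>
  have bounds: "u \<le> min (C / (1 - lam) * v + (4 * p * ln (1 + 2 * d^2)) powr p * OPT n f rs)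
        ((4 * p * ln (1 + 2 / lam * d^2)) powr p * OPT n f rs)"
    if u: "u \<le> (4 * p * ln (1 + 2 * d^2)) powr p * OPT n f rs" and v: "0 \<le> v" and lam: "0 < lam" "lam < 1"
      and p: "0 \<le> p" and O: "0 \<le> OPT n f rs" for u v lam p d n f rs
  proof -
    have "0 \<le> C / (1 - lam) * v" using C v lam by simp
    then have 1: "u \<le> C / (1 - lam) * v + (4 * p * ln (1 + 2 * d^2)) powr p * OPT n f rs" using u by linarith
    have "2 * d^2 \<le> 2 / lam * d^2" using lam by (intro mult_right_mono) (auto simp: field_simps)
    then have "ln (1 + 2 * d^2) \<le> ln (1 + 2 / lam * d^2)" by (subst ln_le_cancel_iff) (auto intro: add_pos_nonneg simp: lam less_imp_le)
    then have "(4 * p * ln (1 + 2 * d^2)) powr p \<le> (4 * p * ln (1 + 2 / lam * d^2)) powr p"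
      using p by (intro powr_mono2 mult_left_mono) auto
    then have "(4 * p * ln (1 + 2 * d^2)) powr p * OPT n f rs \<le> (4 * p * ln (1 + 2 / lam * d^2)) powr p * OPT n f rs"
      using O by (rule mult_right_mono)
    then show ?thesis using 1 u by simp
  qed
  show ?thesis
  proof (intro exI[of _ alg] exI[of _ C] conjI allI impI C)
    fix n f g x' lam rs
    assume as: "admissible_cost n f g \<and> x' \<in> orth n \<and> 0 < lam \<and> lam < (1::real)"
      and rs: "\<forall>a\<in>set rs. valid_row n a"
    have good: "feasible n rs (alg n f x' lam rs) \<and>
       f (alg n f x' lam rs) \<le> (4 * pval n f g * log_sparsity n rs) powr pval n f g * OPT n f rs \<and>
       (feasible n rs x' \<longrightarrow> f (alg n f x' lam rs) \<le> C * f x') \<and>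
       (\<forall>r. valid_row n r \<longrightarrow> vle (alg n f x' lam rs) (alg n f x' lam (rs @ [r])))"
      using alg[of n f g x' lam] as rs unfolding good_def by blast
    show "feasible n rs (alg n f x' lam rs)" using good by blast
    show "vle (alg n f x' lam rs) (alg n f x' lam (rs @ [r]))" if "valid_row n r" for r
      using good that by blast
    assume ne: "rs \<noteq> []"
    have v: "0 \<le> f x'" using as by (simp add: admissible_cost_def)
    have "0 \<le> OPT n f rs"
      using growth_cost.OPT_nonneg[OF max_pval_growth_cost rs] as by blast
    moreover have "0 \<le> pval n f g"
      using growth_cost.p1[OF pval_growth_cost, of n f g] as by (cases "pset n f g = {}") (auto simp: pval_def)
    ultimately have b: "f (alg n f x' lam rs) \<le> min (C / (1 - lam) * f x' +
          (4 * pval n f g * ln (1 + 2 * (real (row_sparsity n rs))^2)) powr pval n f g * OPT n f rs)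
        ((4 * pval n f g * ln (1 + 2 / lam * (real (row_sparsity n rs))^2)) powr pval n f g * OPT n f rs)"
      using good as v by (intro bounds) (auto simp: log_sparsity_def max_sparsity_eq[OF ne rs])
    have "C \<le> C / (1 - lam)" using C as by (simp add: le_divide_eq)
    then have "C * f x' \<le> C / (1 - lam) * f x'" using v by (rule mult_right_mono)
    then show "let xbar = alg n f x' lam rs; p = pval n f g; d = real (row_sparsity n rs) in
               f xbar \<le> min (C / (1 - lam) * f x' + (4 * p * ln (1 + 2 * d^2)) powr p * OPT n f rs)
                             ((4 * p * ln (1 + 2 / lam * d^2)) powr p * OPT n f rs) \<and>
               (feasible n rs x' \<longrightarrow> f xbar \<le> C / (1 - lam) * f x')"
      using b good by (auto simp: Let_def)
  qed
qed

end
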